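(* Let $n\ge 6$ and let $\mathcal{G}=\{G_1,G_2,\ldots,G_n\}$ be a family of graphs on the same vertex set $[n]$ such that $\rho_S(G_i)>2n-4$ for every $i=1,\ldots,n$. Then $\mathcal{G}$ admits a rainbow Hamiltonian cycle, unless $G_1=G_2=\cdots=G_n\cong K_1\vee(K_{n-2}\cup K_1)$.
   Context: For a graph $G$, the signless Laplacian is $S(G)=D(G)+A(G)$ with $D(G)$ the diagonal degree matrix and $A(G)$ the adjacency matrix; $\rho_S(G)$ is the largest eigenvalue of $S(G)$. $K_1\vee(K_{n-2}\cup K_1)$ is $K_{n-1}$ plus one pendant vertex adjacent to one vertex of the $K_{n-1}$. $G_i=G_j$ means equal vertex and edge sets. A rainbow Hamiltonian cycle in $\mathcal{G}$ is a Hamiltonian cycle on the common vertex set whose $n$ edges can be labeled $e_1,\ldots,e_n$ with $e_i\in E(G_i)$ for each $i$. *)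

theory Defs
  imports Complex_Main
begin

definition is_graph :: "nat \<Rightarrow> nat set set \<Rightarrow> bool" where
  "is_graph n E \<longleftrightarrow> (\<forall>e\<in>E. \<exists>u v. e = {u, v} \<and> u \<noteq> v \<and> u \<in> {1..n} \<and> v \<in> {1..n})"

definition degree :: "nat set set \<Rightarrow> nat \<Rightarrow> nat" where
  "degree E v = card {e\<in>E. v \<in> e}"

definition signless_laplacian :: "nat set set \<Rightarrow> nat \<Rightarrow> nat \<Rightarrow> real" where
  "signless_laplacian E u v =
     (if u = v then real (degree E u) else if {u, v} \<in> E then 1 else 0)"

definition is_eigenvalue :: "nat \<Rightarrow> (nat \<Rightarrow> nat \<Rightarrow> real) \<Rightarrow> real \<Rightarrow> bool" where
  "is_eigenvalue n M mu \<longleftrightarrow>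
     (\<exists>x :: nat \<Rightarrow> real. (\<exists>u\<in>{1..n}. x u \<noteq> 0) \<and>
        (\<forall>u\<in>{1..n}. (\<Sum>v=1..n. M u v * x v) = mu * x u))"

definition rho_S :: "nat \<Rightarrow> nat set set \<Rightarrow> real" where
  "rho_S n E = Max {mu. is_eigenvalue n (signless_laplacian E) mu}"

(* K_1 \<or> (K_{n-2} \<union> K_1) on {1..n}: clique on {1..n-1} plus pendant edge {n-1, n} *)
definition K1_join_Kn2_K1 :: "nat \<Rightarrow> nat set set" where
  "K1_join_Kn2_K1 n =
     {{u, v} | u v. u \<in> {1..n-1} \<and> v \<in> {1..n-1} \<and> u \<noteq> v} \<union> {{n - 1, n}}"

definition graph_iso :: "nat \<Rightarrow> nat set set \<Rightarrow> nat set set \<Rightarrow> bool" where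
  "graph_iso n E H \<longleftrightarrow> (\<exists>f. bij_betw f {1..n} {1..n} \<and> E = (\<lambda>e. f ` e) ` H)"

(* Rainbow Hamiltonian cycle of the family G_1..G_n on [n]:
   a cyclic ordering c(0),...,c(n-1) of [n] with cycle edges e_j = {c j, c ((j+1) mod n)},
   and a bijection sigma from colours {1..n} to edge positions {0..<n}
   such that e_(sigma i) is an edge of G_i. *)
definition rainbow_ham_cycle :: "nat \<Rightarrow> (nat \<Rightarrow> nat set set) \<Rightarrow> bool" where
  "rainbow_ham_cycle n G \<longleftrightarrow>
     (\<exists>c sigma. bij_betw c {0..<n} {1..n} \<and> bij_betw sigma {1..n} {0..<n} \<and>
        (\<forall>i\<in>{1..n}. {c (sigma i), c ((sigma i + 1) mod n)} \<in> G i))"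

end

theory Submission
  imports Defs "Jordan_Normal_Form.Spectral_Radius"
begin

text \<open>
  A Collatz--Wielandt estimate with the degree vector as test vector shows that \<open>rho_S > 2 n - 4\<close>
  forces more than \<open>(n - 1) (n - 2) / 2\<close> edges, so every graph of the family misses at most
  \<open>n - 2\<close> edges. Apply the Kelmans shift from \<open>y\<close> to \<open>x < y\<close> to all graphs simultaneously. It
  keeps the edge numbers, and a rainbow Hamiltonian cycle of the shifted family can be rerouted into
  one of the original family, by exchanging \<open>x\<close> and \<open>y\<close> and by reversing the segment between them.
  In a family fixed by all shifts the sets of missing edges are closed upwards, and counting shows
  that the cycle \<open>1, n, 2, n - 1, 3, \<dots>\<close> lies in every graph, except that the edge \<open>{2, n}\<close> is
  missing from the extremal graph. Hence such a family has a rainbow Hamiltonian cycle unless all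
  its graphs are extremal. Finally, if one shift produces the extremal family, the family before
  the shift is extremal itself or has an explicit rainbow Hamiltonian cycle.
\<close>

subsection \<open>Spectral radius and number of edges\<close>

lemma sum_atLeast1_shift: "(\<Sum>v=1..n. f v) = (\<Sum>i<n. f (Suc i))"
  by (metis One_nat_def sum.atLeast1_atMost_eq)

text \<open>Bridge to the matrix library: indices move from \<open>{1..n}\<close> to
  \<open>{0..<n}\<close> and entries become complex, so that finiteness of the complex spectrum
  becomes available.\<close>

lemma is_eigenvalue_eigenvalue:
  assumes "is_eigenvalue n M mu"
  shows "eigenvalue (mat n n (\<lambda>(i, j). complex_of_real (M (Suc i) (Suc j)))) (complex_of_real mu)"
    (is "eigenvalue ?B _")
proof -
  obtain x u where u: "u \<in> {1..n}" "x u \<noteq> 0"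
    and eq: "\<forall>u\<in>{1..n}. (\<Sum>v=1..n. M u v * x v) = mu * x u"
    using assms unfolding is_eigenvalue_def by blast
  let ?v = "vec n (\<lambda>i. complex_of_real (x (Suc i)))"
  have "?v $ (u - 1) \<noteq> 0" using u by auto
  then have nz: "?v \<noteq> 0\<^sub>v n" using u by (metis Suc_le_eq Suc_pred' atLeastAtMost_iff diff_Suc_1 index_zero_vec(1) less_eq_Suc_le One_nat_def)
  have "?B *\<^sub>v ?v = complex_of_real mu \<cdot>\<^sub>v ?v"
  proof (rule eq_vecI)
    fix i assume "i < dim_vec (complex_of_real mu \<cdot>\<^sub>v ?v)"
    then have i: "i < n" by simp
    then have "(\<Sum>v=1..n. M (Suc i) v * x v) = mu * x (Suc i)" using eq by auto
    then have "(\<Sum>j<n. M (Suc i) (Suc j) * x (Suc j)) = mu * x (Suc i)"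
      by (simp only: sum_atLeast1_shift)
    then have "complex_of_real (\<Sum>j<n. M (Suc i) (Suc j) * x (Suc j)) = complex_of_real (mu * x (Suc i))"
      by (simp only:)
    then show "(?B *\<^sub>v ?v) $ i = (complex_of_real mu \<cdot>\<^sub>v ?v) $ i"
      using i by (simp add: scalar_prod_def atLeast0LessThan)
  qed simp
  then show ?thesis unfolding eigenvalue_def eigenvector_def using nz
    by (intro exI[of _ ?v]) auto
qed

text \<open>By symmetry the quadratic form \<open>Q\<close> of a complex eigenvector
  \<open>y\<close> is real, and it equals \<open>k\<close> times the positive number
  \<open>N\<close>; hence \<open>k\<close> is real. The real and imaginary parts of \<open>y\<close>
  then both satisfy the eigenvalue equation, and one of them is nonzero.\<close>

lemma eigenvalue_is_eigenvalue:
  assumes sym: "\<And>u v. M u v = M v u"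
    and ev: "eigenvalue (mat n n (\<lambda>(i, j). complex_of_real (M (Suc i) (Suc j)))) k"
    (is "eigenvalue ?B _")
  shows "is_eigenvalue n M (Re k)"
proof -
  obtain w where w: "w \<in> carrier_vec n" "w \<noteq> 0\<^sub>v n" "?B *\<^sub>v w = k \<cdot>\<^sub>v w"
    using ev unfolding eigenvalue_def eigenvector_def by auto
  define y where "y u = w $ (u - 1)" for u
  have eq: "(\<Sum>v=1..n. complex_of_real (M u v) * y v) = k * y u" if "u \<in> {1..n}" for u
  proof -
    have "(?B *\<^sub>v w) $ (u - 1) = k * y u" using that w(1) unfolding w(3) y_def
      by (metis (no_types, lifting) One_nat_def Suc_pred' Suc_le_eq atLeastAtMost_iff carrier_vecD index_smult_vec(1))
    moreover have "(?B *\<^sub>v w) $ (u - 1) = (\<Sum>j<n. complex_of_real (M u (Suc j)) * y (Suc j))"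
      using that w(1) by (auto simp: scalar_prod_def y_def atLeast0LessThan)
    ultimately show ?thesis by (simp only: sum_atLeast1_shift)
  qed
  have "\<exists>i<n. w $ i \<noteq> 0"
    using w(1,2) by (metis carrier_vecD eq_vecI index_zero_vec)
  then obtain a where a: "a \<in> {1..n}" "y a \<noteq> 0" unfolding y_def
    by (metis Suc_leI atLeastAtMost_iff diff_Suc_1 le_add1 plus_1_eq_Suc)
  define Q where "Q = (\<Sum>u=1..n. \<Sum>v=1..n. cnj (y u) * complex_of_real (M u v) * y v)"
  define N where "N = (\<Sum>u=1..n. cnj (y u) * y u)"
  have "Q = (\<Sum>u=1..n. cnj (y u) * (k * y u))"
    unfolding Q_def using eq by (intro sum.cong refl) (simp add: sum_distrib_left[symmetric] mult.assoc)
  then have QN: "Q = k * N" by (simp add: N_def sum_distrib_left mult.left_commute)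
  have "cnj Q = (\<Sum>u=1..n. \<Sum>v=1..n. cnj (y v) * complex_of_real (M v u) * y u)"
    unfolding Q_def by (simp add: mult_ac sym[symmetric])
  also have "\<dots> = Q" unfolding Q_def by (rule sum.swap)
  finally have cQ: "cnj Q = Q" .
  have Nre: "N = complex_of_real (\<Sum>u=1..n. (cmod (y u))\<^sup>2)"
    unfolding N_def by (simp only: complex_norm_square of_real_sum mult.commute)
  have "0 < (\<Sum>u=1..n. (cmod (y u))\<^sup>2)" using a by (intro sum_pos2[of _ a]) auto
  then have "N \<noteq> 0" "cnj N = N"
    unfolding Nre by (simp_all only: of_real_eq_0_iff complex_cnj_complex_of_real)
  then have "cnj k = k" using cQ QN by simp
  then have kre: "k = complex_of_real (Re k)" by (metis Reals_cnj_iff of_real_Re)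
  have re: "(\<Sum>v=1..n. M u v * Re (y v)) = Re k * Re (y u)" if "u \<in> {1..n}" for u
    using arg_cong[OF eq[OF that], of Re] by (subst (asm) kre) simp
  have im: "(\<Sum>v=1..n. M u v * Im (y v)) = Re k * Im (y u)" if "u \<in> {1..n}" for u
    using arg_cong[OF eq[OF that], of Im] by (subst (asm) kre) simp
  have "Re (y a) \<noteq> 0 \<or> Im (y a) \<noteq> 0" using a by (simp add: complex_eq_iff)
  then show ?thesis
  proof
    assume "Re (y a) \<noteq> 0"
    then show ?thesis unfolding is_eigenvalue_def
      by (intro exI[of _ "\<lambda>u. Re (y u)"]) (use re a in auto)
  next
    assume "Im (y a) \<noteq> 0"
    then show ?thesis unfolding is_eigenvalue_def
      by (intro exI[of _ "\<lambda>u. Im (y u)"]) (use im a in auto)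
  qed
qed

text \<open>\<open>Max\<close> is meaningful only on a finite nonempty set. The real eigenvalues
  embed into the finite complex spectrum, and by symmetry every complex eigenvalue yields a real
  one.\<close>

lemma is_eigenvalue_Max:
  assumes sym: "\<And>u v. M u v = M v u" and n: "n > 0"
  shows "is_eigenvalue n M (Max {mu. is_eigenvalue n M mu})"
proof -
  let ?B = "mat n n (\<lambda>(i, j). complex_of_real (M (Suc i) (Suc j)))"
  have B: "?B \<in> carrier_mat n n" by simp
  have "complex_of_real ` {mu. is_eigenvalue n M mu} \<subseteq> spectrum ?B"
    using is_eigenvalue_eigenvalue by (auto simp: spectrum_def)
  then have "finite {mu. is_eigenvalue n M mu}"
    using card_finite_spectrum(1)[OF B] finite_subset by (metis finite_imageD inj_of_real inj_on_subset subset_UNIV)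
  moreover have "{mu. is_eigenvalue n M mu} \<noteq> {}"
    using spectrum_non_empty[OF B n] eigenvalue_is_eigenvalue[of M, OF sym] unfolding spectrum_def by blast
  ultimately show ?thesis using Max_in by blast
qed

lemma degree_eq_sum:
  assumes "is_graph n E"
  shows "Defs.degree E u = (\<Sum>v=1..n. of_bool ({u, v} \<in> E))"
proof -
  have "{e \<in> E. u \<in> e} = (\<lambda>v. {u, v}) ` {v \<in> {1..n}. {u, v} \<in> E}"
(is "?L = ?R")
  proof
    show "?L \<subseteq> ?R"
    proof
      fix e assume "e \<in> ?L"
      moreover from this obtain a b where "e = {a, b}" "a \<in> {1..n}" "b \<in> {1..n}"
        using assms unfolding is_graph_def by blast
      ultimately show "e \<in> ?R" by (cases "u = a") (auto simp: insert_commute)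
    qed
  qed auto
  moreover have "inj_on (\<lambda>v. {u, v}) {v \<in> {1..n}. {u, v} \<in> E}"
    by (auto simp: inj_on_def doubleton_eq_iff)
  ultimately have "Defs.degree E u = card {v \<in> {1..n}. {u, v} \<in> E}"
    unfolding Defs.degree_def by (simp add: card_image)
  also have "\<dots> = (\<Sum>v=1..n. of_bool ({u, v} \<in> E))"
    by (simp add: of_bool_def sum.If_cases Int_def)
  finally show ?thesis .
qed

text \<open>Collatz--Wielandt bound with the degrees as test vector.\<close>

lemma eigenvalue_le_degree_quotient:
  assumes gr: "is_graph n E" and ev: "is_eigenvalue n (signless_laplacian E) mu" and mu: "mu > 0"
  obtains u where "u \<in> {1..n}" "Defs.degree E u > 0"
    "mu * real (Defs.degree E u) \<le> (real (Defs.degree E u))\<^sup>2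
       + (\<Sum>v=1..n. of_bool ({u, v} \<in> E) * real (Defs.degree E v))"
proof -
  let ?d = "\<lambda>u. real (Defs.degree E u)"
  have irr: "{u} \<notin> E" for u
    using gr unfolding is_graph_def by (auto simp: doubleton_eq_iff)
  obtain x a where a: "a \<in> {1..n}" "x a \<noteq> 0"
    and eq: "\<forall>u\<in>{1..n}. (\<Sum>v=1..n. signless_laplacian E u v * x v) = mu * x u"
    using ev unfolding is_eigenvalue_def by blast
  have eq': "mu * x u = ?d u * x u + (\<Sum>v=1..n. of_bool ({u, v} \<in> E) * x v)" if "u \<in> {1..n}" for u
  proof -
    have "mu * x u = (\<Sum>v=1..n. signless_laplacian E u v * x v)" using eq that by simp
    also have "\<dots> = (\<Sum>v=1..n. (if v = u then ?d u * x u else 0) + of_bool ({u, v} \<in> E) * x v)"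
      by (intro sum.cong) (auto simp: signless_laplacian_def irr)
    also have "\<dots> = ?d u * x u + (\<Sum>v=1..n. of_bool ({u, v} \<in> E) * x v)"
      using that by (simp add: sum.distrib)
    finally show ?thesis .
  qed
  \<comment> \<open>Since \<open>mu > 0\<close>, the eigenvector vanishes at isolated vertices, so
    the quotients below can be restricted to vertices of positive degree.\<close>
  have isol: "x u = 0" if "u \<in> {1..n}" "Defs.degree E u = 0" for u
  proof -
    have "\<forall>v\<in>{1..n}. of_bool ({u, v} \<in> E) = (0::nat)" using that(2) degree_eq_sum[OF gr, of u] by (auto simp del: of_bool_eq_0_iff sum_of_bool_eq)
    then have "(\<Sum>v=1..n. of_bool ({u, v} \<in> E) * x v) = 0" by (intro sum.neutral) auto
    then show ?thesis using eq'[OF that(1)] that(2) mu by simp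
  qed
  let ?P = "{u \<in> {1..n}. Defs.degree E u > 0}"
  let ?q = "\<lambda>u. \<bar>x u\<bar> / ?d u"
  have "a \<in> ?P" using a isol by auto
  then have P: "finite (?q ` ?P)" "?q ` ?P \<noteq> {}" by auto
  \<comment> \<open>At a vertex maximising |x u| / deg u, every entry of \<open>x\<close> is at most
    \<open>?q u\<close> times the degree there. Taking absolute values in the eigenvalue equation at
    \<open>u\<close> and cancelling \<open>?q u\<close> gives the bound.\<close>
  then obtain u where u: "u \<in> ?P" "?q u = Max (?q ` ?P)" using Max_in[OF P] by (metis (no_types, lifting) imageE)
  have mx: "\<bar>x v\<bar> \<le> ?q u * ?d v" if "v \<in> {1..n}" for v
  proof (cases "Defs.degree E v = 0")
    case True then show ?thesis using isol that by simp
  next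
    case False
    then have "?q v \<le> ?q u" unfolding u(2) using that P by (intro Max_ge) auto
    then show ?thesis using False by (simp add: field_simps)
  qed
  have "?q u > 0"
  proof (rule ccontr)
    assume "\<not> ?q u > 0"
    moreover have "?q u \<ge> 0" by simp
    ultimately have "?q u = 0" by linarith
    then have "\<bar>x a\<bar> \<le> 0" using mx[OF a(1)] by (metis mult_zero_left)
    then show False using a(2) by simp
  qed
  moreover have "mu * (?q u * ?d u) \<le> ?q u * ((?d u)\<^sup>2 + (\<Sum>v=1..n. of_bool ({u, v} \<in> E) * ?d v))"
  proof -
    have du: "?q u * ?d u = \<bar>x u\<bar>" using u(1) by simp
    have "mu * \<bar>x u\<bar> = \<bar>?d u * x u + (\<Sum>v=1..n. of_bool ({u, v} \<in> E) * x v)\<bar>"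
      using mu u(1) by (subst eq'[symmetric]) (simp_all add: abs_mult)
    also have "\<dots> \<le> \<bar>?d u * x u\<bar> + \<bar>\<Sum>v=1..n. of_bool ({u, v} \<in> E) * x v\<bar>" by (rule abs_triangle_ineq)
    also have "\<bar>?d u * x u\<bar> = ?d u * (?q u * ?d u)" unfolding du by (simp add: abs_mult)
    also have "\<dots> = ?q u * (?d u)\<^sup>2" by (simp only: power2_eq_square mult_ac)
    also have "\<bar>\<Sum>v=1..n. of_bool ({u, v} \<in> E) * x v\<bar> \<le> (\<Sum>v=1..n. \<bar>of_bool ({u, v} \<in> E) * x v\<bar>)" by (rule sum_abs)
    also have "\<dots> \<le> (\<Sum>v=1..n. of_bool ({u, v} \<in> E) * (?q u * ?d v))"
      by (intro sum_mono) (use mx in auto)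
    also have "\<dots> = ?q u * (\<Sum>v=1..n. of_bool ({u, v} \<in> E) * ?d v)" by (simp only: sum_distrib_left mult.left_commute)
    finally show ?thesis unfolding du distrib_left by simp
  qed
  ultimately have "mu * ?d u \<le> (?d u)\<^sup>2 + (\<Sum>v=1..n. of_bool ({u, v} \<in> E) * ?d v)"
    unfolding mult.left_commute[of mu "?q u"] by (rule mult_left_le_imp_le[rotated])
  then show ?thesis using that u by auto
qed

text \<open>With too few edges, the right-hand side of the degree bound is at most
  \<open>(2 * n - 4)\<close> times the degree of \<open>u\<close>, whatever that degree is, which
  contradicts the assumption on \<open>rho_S\<close>.\<close>

lemma degree_sum_gt_if_rho_S_gt:
  assumes n: "n \<ge> 3" and gr: "is_graph n E" and rho: "rho_S n E > 2 * real n - 4"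
  shows "(\<Sum>u=1..n. Defs.degree E u) > (n - 1) * (n - 2)"
proof (rule ccontr)
  let ?d = "\<lambda>u. Defs.degree E u"
  assume "\<not> ?thesis"
  then have m: "(\<Sum>u=1..n. ?d u) \<le> (n - 1) * (n - 2)" by simp
  have irr: "{u} \<notin> E" for u
    using gr unfolding is_graph_def by (auto simp: doubleton_eq_iff)
  have "is_eigenvalue n (signless_laplacian E) (rho_S n E)"
    unfolding rho_S_def by (rule is_eigenvalue_Max) (use n in \<open>auto simp: signless_laplacian_def insert_commute\<close>)
  moreover have "rho_S n E > 0" using rho n by linarith
  ultimately obtain u where u: "u \<in> {1..n}" "?d u > 0"
    and le: "rho_S n E * real (?d u) \<le> (real (?d u))\<^sup>2 + (\<Sum>v=1..n. of_bool ({u, v} \<in> E) * real (?d v))"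
    using eigenvalue_le_degree_quotient[OF gr] by blast
  let ?N = "{v \<in> {1..n}. {u, v} \<in> E}"
  have cN: "?d u = card ?N" unfolding degree_eq_sum[OF gr] by (simp add: of_bool_def sum.If_cases Int_def)
  have S: "(\<Sum>v=1..n. of_bool ({u, v} \<in> E) * real (?d v)) = real (\<Sum>v\<in>?N. ?d v)"
    by (simp add: sum.inter_filter flip: of_nat_sum) (intro sum.cong, auto)
  have dle: "?d v \<le> n - 1" if "v \<in> {1..n}" for v
  proof -
    have "?d v = card {w \<in> {1..n}. {v, w} \<in> E}" unfolding degree_eq_sum[OF gr] by (simp add: of_bool_def sum.If_cases Int_def)
    also have "\<dots> \<le> card ({1..n} - {v})" using irr by (intro card_mono) auto
    finally show ?thesis using that by simp
  qed
  have split: "(\<Sum>v\<in>?N. ?d v) + (\<Sum>v\<in>{1..n} - ?N. ?d v) = (\<Sum>v=1..n. ?d v)"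
    by (subst add.commute, rule sum.subset_diff[symmetric]) auto
  have uN: "u \<in> {1..n} - ?N" using u irr by auto
  \<comment> \<open>As \<open>u\<close> is not its own neighbour, its degree can be subtracted from
    the total when the neighbour degrees are summed; this saving makes the two largest cases
    work.\<close>
  have du: "?d u \<le> (\<Sum>v\<in>{1..n} - ?N. ?d v)"
    using uN by (intro member_le_sum) auto
  obtain k where k: "n = k + 3" using n by (metis add.commute le_Suc_ex)
  have "?d u * ?d u + (\<Sum>v\<in>?N. ?d v) \<le> (2 * n - 4) * ?d u"
  proof -
    consider "?d u \<le> n - 3" | "?d u = n - 2" | "?d u = n - 1" using dle[OF u(1)] by linarith
    then show ?thesis
    proof cases
      case 1
      have "(\<Sum>v\<in>?N. ?d v) \<le> (n - 1) * ?d u" using sum_bounded_above[of ?N ?d "n-1"] dle cN by (simp add: mult.commute)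
      moreover have "?d u * ?d u \<le> (n - 3) * ?d u" using 1 by simp
      moreover have "(n - 1) * ?d u + (n - 3) * ?d u = (2 * n - 4) * ?d u" by (simp add: k algebra_simps)
      ultimately show ?thesis by linarith
    next
      case 2
      have "(\<Sum>v\<in>?N. ?d v) \<le> (n - 1) * (n - 2) - (n - 2)" using split m du 2 by linarith
      then show ?thesis using 2 k by (simp add: algebra_simps)
    next
      case 3
      have "(\<Sum>v\<in>?N. ?d v) \<le> (n - 1) * (n - 2) - (n - 1)" using split m du 3 by linarith
      then show ?thesis using 3 k by (simp add: algebra_simps)
    qed
  qed
  then have "real (?d u * ?d u + (\<Sum>v\<in>?N. ?d v)) \<le> real ((2 * n - 4) * ?d u)" by (rule of_nat_mono)
  also have "real ((2 * n - 4) * ?d u) = (2 * real n - 4) * real (?d u)" using n by (simp add: of_nat_diff)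
  finally have "rho_S n E * real (?d u) \<le> (2 * real n - 4) * real (?d u)"
    using le S by (simp add: power2_eq_square)
  then show False using rho u(2) by simp
qed


section \<open>Graphs as adjacency relations that are empty outside the vertex set\<close>

definition simple_on :: "nat \<Rightarrow> (nat \<Rightarrow> nat \<Rightarrow> bool) \<Rightarrow> bool" where
  "simple_on n R \<longleftrightarrow> (\<forall>u v. R u v \<longrightarrow> R v u \<and> u \<noteq> v \<and> u \<in> {1..n} \<and> v \<in> {1..n})"

definition deg :: "nat \<Rightarrow> (nat \<Rightarrow> nat \<Rightarrow> bool) \<Rightarrow> nat \<Rightarrow> nat" where
  "deg n R u = (\<Sum>v=1..n. of_bool (R u v))"

text \<open>Here \<tau> sends edge positions to colours, the inverse direction of the bijection in
  \<open>rainbow_ham_cycle\<close>; reordering a cycle then reorders \<open>c\<close> and \<tau>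
  alike.\<close>

definition rainbow :: "nat \<Rightarrow> (nat \<Rightarrow> nat \<Rightarrow> nat \<Rightarrow> bool) \<Rightarrow> bool" where
  "rainbow n A \<longleftrightarrow> (\<exists>c \<tau>. bij_betw c {0..<n} {1..n} \<and> bij_betw \<tau> {0..<n} {1..n} \<and>
     (\<forall>j<n. A (\<tau> j) (c j) (c (Suc j mod n))))"

text \<open>For distinct vertices \<open>p\<close>, \<open>q\<close> this is the extremal graph: a
  clique on all vertices but \<open>p\<close>, which hangs at \<open>q\<close>.\<close>

definition pendant :: "nat \<Rightarrow> nat \<Rightarrow> nat \<Rightarrow> nat \<Rightarrow> nat \<Rightarrow> bool" where
  "pendant n p q u v \<longleftrightarrow> u \<in> {1..n} \<and> v \<in> {1..n} \<and> u \<noteq> v \<and> (u = p \<longrightarrow> v = q) \<and> (v = p \<longrightarrow> u = q)"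

text \<open>Each edge from \<open>y\<close> to a vertex that is not adjacent to \<open>x\<close> is
  moved over to \<open>x\<close>. The cases treat both orders of the endpoints, which keeps the
  relation symmetric; the pair \<open>x\<close>, \<open>y\<close> itself is left alone.\<close>

definition kelmans :: "nat \<Rightarrow> nat \<Rightarrow> (nat \<Rightarrow> nat \<Rightarrow> bool) \<Rightarrow> nat \<Rightarrow> nat \<Rightarrow> bool" where
  "kelmans x y R u v =
     (if u = x \<and> v \<notin> {x, y} then R x v \<or> R y v
      else if u = y \<and> v \<notin> {x, y} then R x v \<and> R y v
      else if v = x \<and> u \<notin> {x, y} then R u x \<or> R u y
      else if v = y \<and> u \<notin> {x, y} then R u x \<and> R u y
      else R u v)"

subsection \<open>Rainbow Hamiltonian cycles\<close>

lemma rainbowI: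
  assumes "bij_betw c {0..<n} {1..n}" "bij_betw \<tau> {0..<n} {1..n}"
    and "\<And>j. Suc j < n \<Longrightarrow> A (\<tau> j) (c j) (c (Suc j))"
    and "A (\<tau> (n - 1)) (c (n - 1)) (c 0)"
  shows "rainbow n A"
proof -
  have "A (\<tau> j) (c j) (c (Suc j mod n))" if "j < n" for j
  proof (cases "Suc j = n")
    case True
    then have "j = n - 1" by simp
    then show ?thesis using assms(4) True by simp
  next
    case False
    then show ?thesis using assms(3) that by simp
  qed
  then show ?thesis unfolding rainbow_def using assms(1,2) by blast
qed

lemma rainbow_obtain_start:
  assumes "rainbow n A" and x: "x \<in> {1..n}"
  obtains c \<tau> where "bij_betw c {0..<n} {1..n}" "bij_betw \<tau> {0..<n} {1..n}" "c 0 = x"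
    "\<And>j. Suc j < n \<Longrightarrow> A (\<tau> j) (c j) (c (Suc j))"
    "A (\<tau> (n - 1)) (c (n - 1)) x"
proof -
  obtain c \<tau> where c: "bij_betw c {0..<n} {1..n}" and \<tau>: "bij_betw \<tau> {0..<n} {1..n}"
    and e: "\<forall>j<n. A (\<tau> j) (c j) (c (Suc j mod n))"
    using assms(1) unfolding rainbow_def by blast
  obtain r where r: "r < n" "c r = x"
    using c x unfolding bij_betw_def by (metis atLeastLessThan_iff imageE)
  define f where "f j = (j + r) mod n" for j
  have "inj_on f {0..<n}"
  proof (rule inj_onI)
    fix i j assume ij: "i \<in> {0..<n}" "j \<in> {0..<n}" "f i = f j"
    then have "(if i + r < n then i + r else i + r - n) = (if j + r < n then j + r else j + r - n)"
      using r by (simp add: f_def mod_if split: if_splits)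
    then show "i = j" using ij r by (auto split: if_splits)
  qed
  moreover have "f ` {0..<n} \<subseteq> {0..<n}" using r by (auto simp: f_def)
  ultimately have f: "bij_betw f {0..<n} {0..<n}"
    by (simp add: bij_betw_def endo_inj_surj)
  have e': "A (\<tau> (f j)) (c (f j)) (c (f (Suc j mod n)))" if "j < n" for j
  proof -
    have "f (Suc j mod n) = Suc (f j) mod n" by (simp add: f_def mod_simps)
    moreover have "f j < n" using r by (simp add: f_def)
    ultimately show ?thesis using e by metis
  qed
  show ?thesis
  proof (rule that[of "c \<circ> f" "\<tau> \<circ> f"])
    show "bij_betw (c \<circ> f) {0..<n} {1..n}" "bij_betw (\<tau> \<circ> f) {0..<n} {1..n}"
      using bij_betw_trans f c \<tau> by blast+
    show "(c \<circ> f) 0 = x" using r by (simp add: f_def)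
    show "A ((\<tau> \<circ> f) j) ((c \<circ> f) j) ((c \<circ> f) (Suc j))" if "Suc j < n" for j
      using e'[of j] that by simp
    show "A ((\<tau> \<circ> f) (n - 1)) ((c \<circ> f) (n - 1)) x"
      using e'[of "n - 1"] r by (simp add: f_def)
  qed
qed

lemma extend_distinct_list:
  assumes "distinct vs" "set vs \<subseteq> {1..n}"
  obtains c where "bij_betw c {0..<n} {1..n}" "\<And>j. j < length vs \<Longrightarrow> c j = vs ! j"
proof -
  define xs where "xs = vs @ sorted_list_of_set ({1..n} - set vs)"
  have d: "distinct xs" and s: "set xs = {1..n}" using assms by (auto simp: xs_def)
  then have "length xs = n" using distinct_card[OF d] by simp
  then have "bij_betw (\<lambda>j. xs ! j) {0..<n} {1..n}"
    using bij_betw_nth[OF d, of "{0..<n}"] s by (auto simp: atLeast0LessThan)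
  then show ?thesis using that by (auto simp: xs_def nth_append)
qed

text \<open>All missing edges are confined to the inner vertices of a given rainbow path. The
  remaining vertices and colours can then be appended in any order, because no further cycle edge
  touches an inner vertex.\<close>

lemma rainbow_of_path:
  assumes vs: "distinct vs" "set vs \<subseteq> {1..n}" and cs: "distinct cs" "set cs \<subseteq> {1..n}"
    and len: "Suc (length cs) = length vs" and n: "n \<ge> 2"
    and path: "\<And>j. j < length cs \<Longrightarrow> A (cs ! j) (vs ! j) (vs ! Suc j)"
    and other: "\<And>i u v. \<lbrakk>i \<in> {1..n}; u \<in> {1..n}; v \<in> {1..n}; u \<noteq> v;
        \<And>j. \<lbrakk>0 < j; j < length cs\<rbrakk> \<Longrightarrow> u \<noteq> vs ! j \<and> v \<noteq> vs ! j\<rbrakk> \<Longrightarrow> A i u v"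
  shows "rainbow n A"
proof -
  obtain c where c: "bij_betw c {0..<n} {1..n}" and cv: "\<And>j. j < length vs \<Longrightarrow> c j = vs ! j"
    using extend_distinct_list[OF vs] by blast
  obtain \<tau> where \<tau>: "bij_betw \<tau> {0..<n} {1..n}" and \<tau>c: "\<And>j. j < length cs \<Longrightarrow> \<tau> j = cs ! j"
    using extend_distinct_list[OF cs] by blast
  have lv: "length vs \<le> n" using distinct_card[OF vs(1)] card_mono[OF _ vs(2)] by simp
  have inj: "c i = c j \<longleftrightarrow> i = j" if "i < n" "j < n" for i j
    using c that unfolding bij_betw_def inj_on_def by auto
  have mem: "c j \<in> {1..n}" "\<tau> j \<in> {1..n}" if "j < n" for j
    using c \<tau> that unfolding bij_betw_def by auto
  have "A (\<tau> j) (c j) (c (Suc j mod n))" if j: "j < n" for j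
  proof (cases "j < length cs")
    case True
    then have "Suc j mod n = Suc j" using len lv by simp
    then show ?thesis using path[OF True] True cv \<tau>c len by simp
  next
    case False
    \<comment> \<open>The successor is either the start of the path, by wrapping around, or lies
      past its last edge; in both cases it is not an inner vertex.\<close>
    have *: "Suc j mod n < n" "Suc j mod n \<noteq> j" "Suc j mod n = 0 \<or> Suc j mod n > length cs"
      using j n False by (cases "Suc j = n"; simp)+
    show ?thesis
    proof (rule other)
      fix l assume l: "0 < l" "l < length cs"
      have "vs ! l = c l" using cv l len by simp
      then show "c j \<noteq> vs ! l \<and> c (Suc j mod n) \<noteq> vs ! l"
        using inj[of j l] inj[of "Suc j mod n" l] j * l False len lv by auto
    qed (use mem inj j * in auto)
  qed
  then show ?thesis unfolding rainbow_def using c \<tau> by blast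
qed

text \<open>The segment from \<open>c 1\<close> to \<open>c (k - 1)\<close> is traversed backwards.
  The colours of the two edges given up, at positions \<open>0\<close> and \<open>k - 1\<close>, are
  reused on the two new edges.\<close>

lemma rainbow_reverse_segment:
  assumes c: "bij_betw c {0..<n} {1..n}" and \<tau>: "bij_betw \<tau> {0..<n} {1..n}"
    and k: "2 \<le> k" "Suc k < n"
    and sym: "\<And>i u v. i \<in> {1..n} \<Longrightarrow> B i u v \<Longrightarrow> B i v u"
    and inner: "\<And>j. \<lbrakk>0 < j; Suc j < n; j \<noteq> k - 1\<rbrakk> \<Longrightarrow> B (\<tau> j) (c j) (c (Suc j))"
    and last: "B (\<tau> (n - 1)) (c (n - 1)) (c 0)"
    and first: "B (\<tau> (k - 1)) (c 0) (c (k - 1))"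
    and turn: "B (\<tau> 0) (c 1) (c k)"
  shows "rainbow n B"
proof -
  define r where "r j = (if 0 < j \<and> j < k then k - j else j)" for j
  \<comment> \<open>Vertices are reversed on positions \<open>1\<close> to \<open>k - 1\<close>, but
    edges on positions \<open>0\<close> to \<open>k - 1\<close>, hence the differing offsets of
    \<open>r\<close> and \<open>t\<close>.\<close>
  define t where "t j = (if j < k then k - 1 - j else j)" for j
  have \<tau>m: "\<tau> j \<in> {1..n}" if "j < n" for j using \<tau> that unfolding bij_betw_def by auto
  have "bij_betw r {0..<n} {0..<n}" "bij_betw t {0..<n} {0..<n}"
    by (rule bij_betw_byWitness[where f' = r], use k in \<open>auto simp: r_def\<close>)
       (rule bij_betw_byWitness[where f' = t], use k in \<open>auto simp: t_def\<close>)
  then have cr: "bij_betw (c \<circ> r) {0..<n} {1..n}" and \<tau>t: "bij_betw (\<tau> \<circ> t) {0..<n} {1..n}"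
    using bij_betw_trans c \<tau> by blast+
  show ?thesis
  proof (rule rainbowI[OF cr \<tau>t])
    fix j assume j: "Suc j < n"
    consider "j = 0" | "0 < j" "Suc j < k" | "Suc j = k" "0 < j" | "j \<ge> k" by linarith
    then show "B ((\<tau> \<circ> t) j) ((c \<circ> r) j) ((c \<circ> r) (Suc j))"
    proof cases
      case 1
      then show ?thesis using first k by (simp add: r_def t_def)
    next
      case 2
      then have "B (\<tau> (k - 1 - j)) (c (k - 1 - j)) (c (Suc (k - 1 - j)))"
        using k by (intro inner) auto
      moreover have "Suc (k - 1 - j) = k - j" "k - 1 - j = k - Suc j" using 2 by auto
      moreover have "\<tau> (k - 1 - j) \<in> {1..n}" using k by (intro \<tau>m) simp
      ultimately have "B (\<tau> (k - 1 - j)) (c (k - j)) (c (k - Suc j))" using sym by metis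
      then show ?thesis using 2 by (simp add: r_def t_def)
    next
      case 3
      then show ?thesis using turn by (auto simp: r_def t_def)
    next
      case 4
      then show ?thesis using inner[of j] j k by (simp add: r_def t_def)
    qed
  next
    show "B ((\<tau> \<circ> t) (n - 1)) ((c \<circ> r) (n - 1)) ((c \<circ> r) 0)"
      using last k by (auto simp: r_def t_def)
  qed
qed

lemma rainbow_relabel:
  assumes "rainbow n (\<lambda>i u v. A i (s u) (s v))" "bij_betw s {1..n} {1..n}"
  shows "rainbow n A"
proof -
  obtain c \<tau> where "bij_betw c {0..<n} {1..n}" "bij_betw \<tau> {0..<n} {1..n}"
    "\<forall>j<n. A (\<tau> j) (s (c j)) (s (c (Suc j mod n)))"
    using assms(1) unfolding rainbow_def by blast
  then show ?thesis unfolding rainbow_def using bij_betw_trans[OF _ assms(2), of c]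
    by (intro exI[of _ "s \<circ> c"] exI[of _ \<tau>]) auto
qed

subsection \<open>Kelmans shifting\<close>

lemma simple_on_kelmans:
  assumes "simple_on n R" "x \<in> {1..n}" "y \<in> {1..n}"
  shows "simple_on n (kelmans x y R)"
proof -
  have s: "R u v \<longleftrightarrow> R v u" and V: "R u v \<Longrightarrow> u \<noteq> v \<and> u \<in> {1..n} \<and> v \<in> {1..n}" for u v
    using assms(1) unfolding simple_on_def by blast+
  have "kelmans x y R v u \<and> u \<noteq> v \<and> u \<in> {1..n} \<and> v \<in> {1..n}" if k: "kelmans x y R u v" for u v
  proof -
    have "kelmans x y R v u = kelmans x y R u v"
      using s[of u v] s[of u x] s[of u y] s[of v x] s[of v y] by (simp add: kelmans_def)
    moreover have "u \<noteq> v" using k V[of u u] by (cases "u = v") (simp_all add: kelmans_def split: if_splits)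
    moreover have "u = x \<or> u = y \<or> R u v \<or> R u x \<or> R u y" "v = x \<or> v = y \<or> R u v \<or> R x v \<or> R y v"
      using k by (simp_all add: kelmans_def split: if_splits)
    then have "u \<in> {1..n}" "v \<in> {1..n}" using V assms(2,3) by blast+
    ultimately show ?thesis using k by blast
  qed
  then show ?thesis unfolding simple_on_def by blast
qed

text \<open>
  Let \<open>a, b\<close> be the neighbours of \<open>x\<close> on the cycle of the shifted family. The edges at \<open>y\<close> are
  present at \<open>x\<close> as well, so only \<open>a\<close> and \<open>b\<close> matter: if both were moved, exchange \<open>x\<close> and \<open>y\<close>;
  if one of them was moved, reverse the segment between \<open>x\<close> and \<open>y\<close>, exchanging them if necessary.
  The exchange is handled by passing to the relabelled family \<open>B\<close>.
\<close>

lemma rainbow_kelmans: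
  assumes simp: "\<And>i. i \<in> {1..n} \<Longrightarrow> simple_on n (A i)"
    and xy: "x \<in> {1..n}" "y \<in> {1..n}" "x \<noteq> y" and n: "n \<ge> 3"
    and rb: "rainbow n (\<lambda>i. kelmans x y (A i))"
  shows "rainbow n A"
proof -
  obtain c \<tau> where c: "bij_betw c {0..<n} {1..n}" and \<tau>: "bij_betw \<tau> {0..<n} {1..n}" and c0: "c 0 = x"
    and e: "\<And>j. Suc j < n \<Longrightarrow> kelmans x y (A (\<tau> j)) (c j) (c (Suc j))"
    and el: "kelmans x y (A (\<tau> (n - 1))) (c (n - 1)) x"
    using rainbow_obtain_start[OF rb xy(1)] by metis
  obtain k where k: "k < n" "c k = y"
    using c xy unfolding bij_betw_def by (metis atLeastLessThan_iff imageE)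
  then have k0: "k > 0" using c0 xy by (cases k) auto
  have inj: "c i = c j \<longleftrightarrow> i = j" if "i < n" "j < n" for i j
    using c that unfolding bij_betw_def inj_on_def by auto
  have cx: "c j = x \<longleftrightarrow> j = 0" and cy: "c j = y \<longleftrightarrow> j = k" if "j < n" for j
    using inj[of j 0] inj[of j k] that k c0 by auto
  have \<tau>m: "\<tau> j \<in> {1..n}" if "j < n" for j using \<tau> that unfolding bij_betw_def by auto
  have sym: "A i u v \<Longrightarrow> A i v u" if "i \<in> {1..n}" for i u v
    using simp[OF that] unfolding simple_on_def by blast
  define s where "s v = (if v = x then y else if v = y then x else v)" for v
  have s: "bij_betw s {1..n} {1..n}"
    by (rule bij_betw_byWitness[where f' = s]) (use xy in \<open>auto simp: s_def\<close>)
  \<comment> \<open>A rainbow cycle for \<open>B\<close> is one for \<open>A\<close> after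
    exchanging \<open>x\<close> and \<open>y\<close>, so each case below may aim at whichever family
    fits.\<close>
  define B where "B i u v = A i (s u) (s v)" for i u v
  have rB: "rainbow n A" if "rainbow n B" using rainbow_relabel[OF _ s, of A] that unfolding B_def by blast
  have symB: "B i u v \<Longrightarrow> B i v u" if "i \<in> {1..n}" for i u v
    using sym[OF that] unfolding B_def by blast
  have sx: "s x = y" "s y = x" and sz: "\<And>z. z \<noteq> x \<Longrightarrow> z \<noteq> y \<Longrightarrow> s z = z"
    using xy by (auto simp: s_def)
  have inn: "A (\<tau> j) (c j) (c (Suc j))" "B (\<tau> j) (c j) (c (Suc j))"
    if "0 < j" "Suc j < n" "j \<noteq> k" "Suc j \<noteq> k" for j
    using e[of j] cx[of j] cy[of j] cx[of "Suc j"] cy[of "Suc j"] that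
    by (auto simp: kelmans_def B_def sz)
  have kn: "A (\<tau> k) (c k) (c (Suc k))" "B (\<tau> k) (c k) (c (Suc k))" if "Suc k < n"
    using e[OF that] cx[of "Suc k"] cy[of "Suc k"] that xy
    by (auto simp: kelmans_def B_def sx sz k)
  \<comment> \<open>A shifted edge from \<open>y\<close> to a third vertex requires that vertex to
    be adjacent to both \<open>x\<close> and \<open>y\<close>; it is therefore usable with either
    endpoint, in \<open>A\<close> and in \<open>B\<close>.\<close>
  have kp: "A (\<tau> (k - 1)) (c (k - 1)) x" "A (\<tau> (k - 1)) (c (k - 1)) y"
     "B (\<tau> (k - 1)) (c (k - 1)) x" "B (\<tau> (k - 1)) (c (k - 1)) y" if "2 \<le> k"
    using e[of "k - 1"] cx[of "k - 1"] cy[of "k - 1"] that xy k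
    by (auto simp: kelmans_def B_def sx sz)
  show ?thesis
  proof (cases "k = 1")
    case True
    \<comment> \<open>The edge between \<open>x\<close> and \<open>y\<close> is unaffected by the
      shift, and by symmetry also by the exchange.\<close>
    have z: "A (\<tau> 0) x y" using e[of 0] n c0 k xy True by (simp add: kelmans_def)
    then have zB: "B (\<tau> 0) x y" using sym \<tau>m[of 0] n by (simp add: B_def sx)
    have cn: "c (n - 1) \<noteq> x" "c (n - 1) \<noteq> y" using cx[of "n - 1"] cy[of "n - 1"] n True by auto
    then have "A (\<tau> (n - 1)) (c (n - 1)) x \<or> B (\<tau> (n - 1)) (c (n - 1)) x"
      using el xy by (auto simp: kelmans_def B_def sx sz)
    then show ?thesis
    proof
      assume l: "A (\<tau> (n - 1)) (c (n - 1)) x"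
      show ?thesis
      proof (rule rainbowI[OF c \<tau>])
        fix j assume j: "Suc j < n"
        consider "j = 0" | "j = 1" | "j > 1" by linarith
        then show "A (\<tau> j) (c j) (c (Suc j))"
          by cases (use z c0 k True kn inn j in auto)
      qed (use l c0 in simp)
    next
      assume l: "B (\<tau> (n - 1)) (c (n - 1)) x"
      show ?thesis
      proof (rule rB, rule rainbowI[OF c \<tau>])
        fix j assume j: "Suc j < n"
        consider "j = 0" | "j = 1" | "j > 1" by linarith
        then show "B (\<tau> j) (c j) (c (Suc j))"
          by cases (use zB c0 k True kn inn j in auto)
      qed (use l c0 in simp)
    qed
  next
    case False
    then have k2: "2 \<le> k" using k0 by simp
    have c1: "c 1 \<noteq> x" "c 1 \<noteq> y" using cx[of 1] cy[of 1] n False by auto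
    \<comment> \<open>The first edge stems from \<open>x\<close> or from \<open>y\<close>. If it
      fails to start at \<open>x\<close> in one of the families, it joins \<open>c 1\<close> to
      \<open>y\<close> there, which is the turning edge needed for a reversal.\<close>
    then have f: "A (\<tau> 0) x (c 1) \<or> B (\<tau> 0) x (c 1)"
      and fA: "A (\<tau> 0) x (c 1) \<or> A (\<tau> 0) (c 1) y"
      and fB: "B (\<tau> 0) x (c 1) \<or> B (\<tau> 0) (c 1) y"
      using e[of 0] n c0 sym \<tau>m[of 0] xy by (auto simp: kelmans_def B_def sx sz)
    have eA: "A (\<tau> j) (c j) (c (Suc j))" if "A (\<tau> 0) x (c 1)" "Suc j < n" for j
    proof -
      consider "j = 0" | "Suc j = k" "j > 0" | "j = k" | "0 < j" "j \<noteq> k" "Suc j \<noteq> k" by linarith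
      then show ?thesis by cases (use that c0 k kp kn inn k2 in auto)
    qed
    have eB: "B (\<tau> j) (c j) (c (Suc j))" if "B (\<tau> 0) x (c 1)" "Suc j < n" for j
    proof -
      consider "j = 0" | "Suc j = k" "j > 0" | "j = k" | "0 < j" "j \<noteq> k" "Suc j \<noteq> k" by linarith
      then show ?thesis by cases (use that c0 k kp kn inn k2 in auto)
    qed
    show ?thesis
    proof (cases "Suc k = n")
      case True
      \<comment> \<open>Now \<open>y\<close> is the predecessor of \<open>x\<close>, so the closing
        edge exists in both families and the first edge alone decides between them.\<close>
      have "A (\<tau> (n - 1)) y x" using el k xy True by (auto simp: kelmans_def)
      moreover have "B (\<tau> (n - 1)) y x" using calculation sym \<tau>m[of "n - 1"] n by (simp add: B_def sx)
      moreover have "c (n - 1) = y" using k True by auto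
      ultimately show ?thesis
        using f eA eB rainbowI[OF c \<tau>, of A] rB rainbowI[OF c \<tau>, of B] c0 by metis
    next
      case False
      then have kn': "Suc k < n" using k by simp
      have cn: "c (n - 1) \<noteq> x" "c (n - 1) \<noteq> y" using cx[of "n - 1"] cy[of "n - 1"] n kn' by auto
      then have l: "A (\<tau> (n - 1)) (c (n - 1)) x \<or> B (\<tau> (n - 1)) (c (n - 1)) x"
        using el xy by (auto simp: kelmans_def B_def sx sz)
      have inA: "A (\<tau> j) (c j) (c (Suc j))" and inB: "B (\<tau> j) (c j) (c (Suc j))"
        if "0 < j" "Suc j < n" "j \<noteq> k - 1" for j
        using that inn[of j] kn by (cases "j = k"; force)+
      have t: "\<tau> (k - 1) \<in> {1..n}" using k by (intro \<tau>m) simp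
      \<comment> \<open>The closing edge selects the family; the first edge then decides whether the
        segment between \<open>x\<close> and \<open>y\<close> has to be reversed.\<close>
      from l show ?thesis
      proof
        assume lA: "A (\<tau> (n - 1)) (c (n - 1)) x"
        from fA show ?thesis
        proof
          assume "A (\<tau> 0) x (c 1)"
          then show ?thesis using eA lA c0 by (intro rainbowI[OF c \<tau>]) auto
        next
          assume "A (\<tau> 0) (c 1) y"
          then show ?thesis
            using rainbow_reverse_segment[where B = A, OF c \<tau> k2 kn' sym inA] lA c0 k kp[OF k2] sym[OF t] by simp
        qed
      next
        assume lB: "B (\<tau> (n - 1)) (c (n - 1)) x"
        from fB show ?thesis
        proof
          assume "B (\<tau> 0) x (c 1)"
          then show ?thesis using eB lB c0 by (intro rB rainbowI[OF c \<tau>]) auto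
        next
          assume "B (\<tau> 0) (c 1) y"
          then show ?thesis
            using rB rainbow_reverse_segment[where B = B, OF c \<tau> k2 kn' symB inB] lB c0 k kp[OF k2] symB[OF t] by simp
        qed
      qed
    qed
  qed
qed

section \<open>Degrees under a shift\<close>

lemma sum_split_two:
  fixes f :: "nat \<Rightarrow> nat"
  assumes "x \<in> {1..n}" "y \<in> {1..n}" "x \<noteq> y"
  shows "(\<Sum>v=1..n. f v) = (\<Sum>v\<in>{1..n} - {x, y}. f v) + f x + f y"
proof -
  have "(\<Sum>v=1..n. f v) = (\<Sum>v\<in>{1..n} - {x, y}. f v) + (\<Sum>v\<in>{x, y}. f v)"
    using assms by (intro sum.subset_diff) auto
  then show ?thesis using assms by simp
qed

lemma deg_kelmans_other:
  assumes "x \<in> {1..n}" "y \<in> {1..n}" "x \<noteq> y" "z \<notin> {x, y}"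
  shows "deg n (kelmans x y R) z = deg n R z"
proof -
  have "(\<Sum>v\<in>{1..n} - {x, y}. of_bool (kelmans x y R z v)) = (\<Sum>v\<in>{1..n} - {x, y}. of_bool (R z v) :: nat)"
    using assms by (intro sum.cong) (auto simp: kelmans_def)
  moreover have "of_bool (kelmans x y R z x) + of_bool (kelmans x y R z y) = (of_bool (R z x) + of_bool (R z y) :: nat)"
    using assms by (auto simp: kelmans_def)
  ultimately show ?thesis unfolding deg_def sum_split_two[OF assms(1-3)] by linarith
qed

lemma deg_kelmans_pair:
  assumes "x \<in> {1..n}" "y \<in> {1..n}" "x \<noteq> y" and R: "simple_on n R"
  shows "deg n (kelmans x y R) x + deg n (kelmans x y R) y = deg n R x + deg n R y"
proof -
  have "(\<Sum>v\<in>{1..n} - {x, y}. of_bool (kelmans x y R x v) + of_bool (kelmans x y R y v)) =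
      (\<Sum>v\<in>{1..n} - {x, y}. of_bool (R x v) + of_bool (R y v) :: nat)"
    using assms by (intro sum.cong) (auto simp: kelmans_def)
  moreover have "kelmans x y R a b = R a b" if "a \<in> {x, y}" "b \<in> {x, y}" for a b
    using that by (auto simp: kelmans_def)
  ultimately show ?thesis unfolding deg_def sum_split_two[OF assms(1-3)] by (simp add: sum.distrib del: sum_of_bool_eq)
qed

lemma deg_kelmans_mono:
  assumes "x \<in> {1..n}" "y \<in> {1..n}" "x \<noteq> y" and R: "simple_on n R"
  shows "deg n R x \<le> deg n (kelmans x y R) x"
    and "kelmans x y R \<noteq> R \<Longrightarrow> deg n R x < deg n (kelmans x y R) x"
proof -
  have le: "of_bool (R x v) \<le> (of_bool (kelmans x y R x v) :: nat)" for v
    by (auto simp: kelmans_def)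
  then show "deg n R x \<le> deg n (kelmans x y R) x" unfolding deg_def by (intro sum_mono)
  assume "kelmans x y R \<noteq> R"
  then obtain u v where uv: "kelmans x y R u v \<noteq> R u v" by (auto simp: fun_eq_iff)
  have s: "R u v \<longleftrightarrow> R v u" for u v using R unfolding simple_on_def by blast
  \<comment> \<open>A shift has an effect only if some third vertex is adjacent to \<open>y\<close>
    and not to \<open>x\<close>; \<open>x\<close> gains this neighbour.\<close>
  have "\<exists>z. R y z \<and> \<not> R x z \<and> z \<notin> {x, y}"
    using uv s unfolding kelmans_def by (auto split: if_splits)
  then obtain z where z: "R y z" "\<not> R x z" "z \<notin> {x, y}" by blast
  then have zn: "z \<in> {1..n}" using R unfolding simple_on_def by blast
  have "of_bool (R x z) < (of_bool (kelmans x y R x z) :: nat)" using z by (auto simp: kelmans_def)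
  then show "deg n R x < deg n (kelmans x y R) x"
    unfolding deg_def using le zn by (intro sum_strict_mono_ex1) auto
qed

lemma sum_deg_kelmans:
  assumes "x \<in> {1..n}" "y \<in> {1..n}" "x \<noteq> y" "simple_on n R"
  shows "(\<Sum>u=1..n. deg n (kelmans x y R) u) = (\<Sum>u=1..n. deg n R u)"
proof -
  have "(\<Sum>u\<in>{1..n} - {x, y}. deg n (kelmans x y R) u) = (\<Sum>u\<in>{1..n} - {x, y}. deg n R u)"
    using deg_kelmans_other[OF assms(1-3)] by (intro sum.cong) auto
  then show ?thesis
    unfolding sum_split_two[OF assms(1-3)] using deg_kelmans_pair[OF assms] by linarith
qed

text \<open>The termination measure for repeated shifting: \<open>d\<close> units of degree move
  from \<open>y\<close> to the smaller label \<open>x\<close>, and all other degrees stay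
  fixed.\<close>

lemma weighted_deg_kelmans:
  assumes "x \<in> {1..n}" "y \<in> {1..n}" "x < y" "simple_on n R"
  shows "(\<Sum>u=1..n. u * deg n (kelmans x y R) u) \<le> (\<Sum>u=1..n. u * deg n R u)"
    and "kelmans x y R \<noteq> R \<Longrightarrow> (\<Sum>u=1..n. u * deg n (kelmans x y R) u) < (\<Sum>u=1..n. u * deg n R u)"
proof -
  have xy: "x \<noteq> y" using assms by simp
  note a = assms(1,2) xy
  obtain d where d: "deg n (kelmans x y R) x = deg n R x + d"
    using deg_kelmans_mono(1)[OF a assms(4)] le_Suc_ex by blast
  then have d': "deg n R y = deg n (kelmans x y R) y + d"
    using deg_kelmans_pair[OF a assms(4)] by linarith
  have eq: "(\<Sum>u\<in>{1..n} - {x, y}. u * deg n (kelmans x y R) u) = (\<Sum>u\<in>{1..n} - {x, y}. u * deg n R u)"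
    using deg_kelmans_other[OF a] by (intro sum.cong) auto
  have "x * d \<le> y * d" using assms by simp
  then show "(\<Sum>u=1..n. u * deg n (kelmans x y R) u) \<le> (\<Sum>u=1..n. u * deg n R u)"
    unfolding sum_split_two[OF a] eq d d' by (simp add: algebra_simps)
  assume "kelmans x y R \<noteq> R"
  then have "d > 0" using deg_kelmans_mono(2)[OF a assms(4)] d by simp
  then have "x * d < y * d" using assms by simp
  then show "(\<Sum>u=1..n. u * deg n (kelmans x y R) u) < (\<Sum>u=1..n. u * deg n R u)"
    unfolding sum_split_two[OF a] eq d d' by (simp add: algebra_simps)
qed

subsection \<open>Families fixed by all shifts\<close>

text \<open>In the square of all ordered pairs, \<open>T\<close>, its mirror image, the diagonal and
  the ordered adjacent pairs are disjoint. Hence twice \<open>card T\<close> is less than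
  \<open>n * n - n - (n - 1) * (n - 2) = 2 * (n - 1)\<close>.\<close>

lemma card_missing_le:
  assumes R: "simple_on n R" and m: "(n - 1) * (n - 2) < (\<Sum>u=1..n. deg n R u)" and n: "n \<ge> 2"
    and T: "\<And>u v. (u, v) \<in> T \<Longrightarrow> u \<in> {1..n} \<and> v \<in> {1..n} \<and> u < v \<and> \<not> R u v"
  shows "card T \<le> n - 2"
proof -
  let ?E = "{(u, v) \<in> {1..n} \<times> {1..n}. R u v}"
  have "(\<Sum>u=1..n. deg n R u) = (\<Sum>u=1..n. card {v \<in> {1..n}. R u v})"
    unfolding deg_def by (simp add: Int_def)
  also have "\<dots> = card (SIGMA u:{1..n}. {v \<in> {1..n}. R u v})" by simp
  also have "(SIGMA u:{1..n}. {v \<in> {1..n}. R u v}) = ?E" by auto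
  finally have E: "(\<Sum>u=1..n. deg n R u) = card ?E" .
  let ?T' = "prod.swap ` T" and ?D = "(\<lambda>u. (u, u)) ` {1..n}"
  have fin: "finite T" by (rule finite_subset[of _ "{1..n} \<times> {1..n}"]) (use T in auto)
  have s: "R u v \<Longrightarrow> R v u \<and> u \<noteq> v" for u v using R unfolding simple_on_def by blast
  have finE: "finite ?E" by (rule finite_subset[of _ "{1..n} \<times> {1..n}"]) auto
  have dj: "T \<inter> ?T' = {}" "(T \<union> ?T') \<inter> ?D = {}" "(T \<union> ?T' \<union> ?D) \<inter> ?E = {}"
    using T s by (force dest: T)+
  have "card T + card ?T' + card ?D + card ?E = card (T \<union> ?T' \<union> ?D \<union> ?E)"
    using fin finE dj by (simp add: card_Un_disjoint)
  also have "\<dots> \<le> card ({1..n} \<times> {1..n})"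
    by (rule card_mono) (use T in \<open>auto dest: T\<close>)
  also have "card ?T' = card T" by (intro card_image inj_onI) auto
  finally have "card T + card T + n + card ?E \<le> n * n"
    by (simp add: card_image inj_on_def)
  moreover obtain k where "n = k + 2" using n by (metis add.commute le_Suc_ex)
  ultimately show ?thesis using m E by (simp add: algebra_simps)
qed

lemma shifted_upward_closed:
  assumes R: "simple_on n R" and st: "\<And>x y. \<lbrakk>x \<in> {1..n}; y \<in> {1..n}; x < y\<rbrakk> \<Longrightarrow> kelmans x y R = R"
    and a: "1 \<le> a" "a < b" "\<not> R a b" "a \<le> a'" "b \<le> b'" "a' < b'" "b' \<le> n"
  shows "\<not> R a' b'"
proof
  assume r: "R a' b'"
  have sym: "R u v \<longleftrightarrow> R v u" for u v using R unfolding simple_on_def by blast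
  have mono: "R x z" if "R y z" "x \<in> {1..n}" "y \<in> {1..n}" "x < y" "z \<notin> {x, y}" for x y z
  proof -
    have "kelmans x y R x z" using that by (simp add: kelmans_def)
    then show ?thesis using st that by simp
  qed
  \<comment> \<open>The smaller endpoint is lowered first: \<open>a'\<close> may equal
    \<open>b\<close>, whereas \<open>a < b\<close> keeps the intermediate pair \<open>a\<close>,
    \<open>b'\<close> distinct from \<open>b\<close>.\<close>
  have "R a b'" using r mono[of a' b' a] a by (cases "a = a'") auto
  then have "R b a" using sym mono[of b' a b] a by (cases "b = b'") auto
  then show False using sym a by blast
qed

text \<open>Upward closure turns one missing edge into all pairs above it, and for a small enough
  sum of endpoints these number more than \<open>n - 2\<close>.\<close>

lemma shifted_edge:
  assumes n: "n \<ge> 6" and R: "simple_on n R" and m: "(n - 1) * (n - 2) < (\<Sum>u=1..n. deg n R u)"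
    and st: "\<And>x y. \<lbrakk>x \<in> {1..n}; y \<in> {1..n}; x < y\<rbrakk> \<Longrightarrow> kelmans x y R = R"
    and a: "1 \<le> a" "a < b" "b \<le> n" "a + b \<le> n + 2" "(a, b) \<noteq> (2, n)"
  shows "R a b"
proof (rule ccontr)
  assume nR: "\<not> R a b"
  note up = shifted_upward_closed[OF R st a(1,2) nR]
  \<comment> \<open>The pairs with larger endpoint \<open>b'\<close> that upward closure may force
    to be missing; column \<open>b'\<close> has \<open>b' - a\<close> of them.\<close>
  let ?C = "\<lambda>b'. (\<lambda>a'. (a', b')) ` {a..<b'}"
  have cC: "card (?C b') = b' - a" for b' by (simp add: card_image inj_on_def)
  have le: "card T \<le> n - 2" if "T \<subseteq> (\<Union>b'\<in>{b..n}. ?C b')" for T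
    using that a up n by (intro card_missing_le[OF R m]) fastforce+
  show False
  proof (cases "b = n")
    case True
    then have "a = 1" using a by auto
    moreover have "card (?C n) \<le> n - 2" using True by (intro le) auto
    ultimately show False using cC[of n] n by simp
  next
    case False
    then have bn: "b \<le> n - 1" using a by simp
    have un: "?C n \<union> ?C (n - 1) \<subseteq> (\<Union>b'\<in>{b..n}. ?C b')"
      using bn by (intro Un_least UN_upper) auto
    have cu: "card (?C n \<union> ?C (n - 1)) = (n - a) + (n - 1 - a)"
      unfolding cC[symmetric] using n by (intro card_Un_disjoint) auto
    show False
    proof (cases "2 * a \<le> n")
      case True
      then show False using le[OF un] cu n by linarith
    next
      case f: False
      \<comment> \<open>The two last columns contain only \<open>n - 2\<close> missing edges here; \<open>{a, b}\<close> is one more.\<close>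
      then have b: "b = a + 1" "2 * a = n + 1" using a by linarith+
      let ?T = "insert (a, b) (?C n \<union> ?C (n - 1))"
      \<comment> \<open>Here \<open>b = (n + 3) / 2\<close>, which is below \<open>n - 1\<close>
        because \<open>n\<close> is at least \<open>6\<close>.\<close>
      have "(a, b) \<notin> ?C n \<union> ?C (n - 1)" using b n by auto
      then have "card ?T = Suc ((n - a) + (n - 1 - a))" using cu by simp
      moreover have "card ?T \<le> n - 2" using un a
        by (intro le insert_subsetI UN_I[of b]) auto
      ultimately show False using b n by linarith
    qed
  qed
qed

text \<open>Once \<open>{2, n}\<close> is missing, so are all \<open>n - 2\<close> edges from
  \<open>n\<close> to \<open>2, ..., n - 1\<close>. This exhausts the permitted number of missing
  edges.\<close>

lemma shifted_eq_pendant: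
  assumes n: "n \<ge> 6" and R: "simple_on n R" and m: "(n - 1) * (n - 2) < (\<Sum>u=1..n. deg n R u)"
    and st: "\<And>x y. \<lbrakk>x \<in> {1..n}; y \<in> {1..n}; x < y\<rbrakk> \<Longrightarrow> kelmans x y R = R"
    and nR: "\<not> R 2 n"
  shows "R = pendant n n 1"
proof -
  have sym: "R u v \<longleftrightarrow> R v u" and V: "R u v \<Longrightarrow> u \<noteq> v \<and> u \<in> {1..n} \<and> v \<in> {1..n}" for u v
    using R unfolding simple_on_def by blast+
  have up: "\<not> R a n" if "2 \<le> a" "a < n" for a
    using shifted_upward_closed[OF R st _ _ nR, of a n] that n by simp
  have one: "R 1 n" using shifted_edge[OF n R m st, of 1 n] n by simp
  have low: "R a b" if ab: "1 \<le> a" "a < b" "b < n" for a b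
  proof (rule ccontr)
    assume "\<not> R a b"
    then have "card (insert (a, b) ((\<lambda>u. (u, n)) ` {2..<n})) \<le> n - 2"
      using ab up n by (intro card_missing_le[OF R m]) auto
    moreover have "(a, b) \<notin> (\<lambda>u. (u, n)) ` {2..<n}" using ab by auto
    ultimately show False by (simp add: card_image inj_on_def n)
  qed
  have "R u v = pendant n n 1 u v" if "u < v" for u v
  proof (cases "1 \<le> u \<and> v \<le> n")
    case True
    show ?thesis
    proof (cases "v = n")
      case True
      then show ?thesis using \<open>1 \<le> u \<and> v \<le> n\<close> that one up[of u] by (cases "u = 1") (auto simp: pendant_def)
    next
      case False
      then show ?thesis using True that low[of u v] by (auto simp: pendant_def)
    qed
  next
    case False
    then show ?thesis using V[of u v] by (auto simp: pendant_def)
  qed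
  moreover have "pendant n n 1 u v = pendant n n 1 v u" for u v by (auto simp: pendant_def)
  moreover have "R u u = pendant n n 1 u u" for u using V by (auto simp: pendant_def)
  ultimately show ?thesis using sym by (intro ext) (metis linorder_neqE_nat)
qed

section \<open>A Hamiltonian cycle for the fixed families\<close>

text \<open>Consecutive entries sum alternately to \<open>n + 1\<close> and \<open>n + 2\<close>,
  within the range of \<open>shifted_edge\<close>. The exceptional pair \<open>n\<close>,
  \<open>2\<close> occupies positions \<open>1\<close> and \<open>2\<close>.\<close>

definition zigzag :: "nat \<Rightarrow> nat \<Rightarrow> nat" where
  "zigzag n j = (if even j then j div 2 + 1 else n - j div 2)"

lemma bij_betw_zigzag: "bij_betw (zigzag n) {0..<n} {1..n}"
proof -
  have inj: "inj_on (zigzag n) {0..<n}"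
  proof (rule inj_onI)
    fix i j assume "i \<in> {0..<n}" "j \<in> {0..<n}" "zigzag n i = zigzag n j"
    then show "i = j" unfolding zigzag_def by (auto split: if_splits elim!: evenE oddE)
  qed
  moreover have "zigzag n ` {0..<n} \<subseteq> {1..n}" unfolding zigzag_def by (auto elim!: oddE)
  ultimately show ?thesis unfolding bij_betw_def
    by (intro conjI inj card_subset_eq) (auto simp: card_image)
qed

lemma rainbow_shifted:
  assumes n: "n \<ge> 6" and R: "\<And>i. i \<in> {1..n} \<Longrightarrow> simple_on n (A i)"
    and m: "\<And>i. i \<in> {1..n} \<Longrightarrow> (n - 1) * (n - 2) < (\<Sum>u=1..n. deg n (A i) u)"
    and st: "\<And>i x y. \<lbrakk>i \<in> {1..n}; x \<in> {1..n}; y \<in> {1..n}; x < y\<rbrakk> \<Longrightarrow> kelmans x y (A i) = A i"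
    and i0: "i0 \<in> {1..n}" "A i0 2 n"
  shows "rainbow n A"
proof -
  \<comment> \<open>A filler colour for position \<open>0\<close>, so that \<open>i0\<close>, whose
    graph contains \<open>{2, n}\<close>, lands on position \<open>1\<close>.\<close>
  define i1 where "i1 = (if i0 = 1 then 2 else 1 :: nat)"
  have "distinct [i1, i0]" "set [i1, i0] \<subseteq> {1..n}" using i0 n by (auto simp: i1_def)
  then obtain \<tau> where \<tau>: "bij_betw \<tau> {0..<n} {1..n}" and "\<And>j. j < length [i1, i0] \<Longrightarrow> \<tau> j = [i1, i0] ! j"
    using extend_distinct_list by blast
  from this(2)[of 1] have \<tau>1: "\<tau> 1 = i0" by simp
  have \<tau>m: "\<tau> j \<in> {1..n}" if "j < n" for j using \<tau> that unfolding bij_betw_def by auto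
  have zm: "zigzag n j \<in> {1..n}" if "j < n" for j using bij_betw_zigzag[of n] that unfolding bij_betw_def by auto
  have zinj: "zigzag n i = zigzag n j \<longleftrightarrow> i = j" if "i < n" "j < n" for i j
    using bij_betw_zigzag[of n] that unfolding bij_betw_def inj_on_def by auto
  have sym: "A i u v \<Longrightarrow> A i v u" if "i \<in> {1..n}" for i u v
    using R[OF that] unfolding simple_on_def by blast
  have edge: "A i a b" if "i \<in> {1..n}" "a \<in> {1..n}" "b \<in> {1..n}" "a \<noteq> b" "a + b \<le> n + 2" "{a, b} \<noteq> {2, n}" for i a b
  proof (cases "a < b")
    case True
    then show ?thesis using that st by (intro shifted_edge[OF n R m]) auto
  next
    case False
    then have "A i b a" using that st by (intro shifted_edge[OF n R m]) (auto simp: insert_commute)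
    then show ?thesis using sym that by blast
  qed
  show ?thesis
  proof (rule rainbowI[OF bij_betw_zigzag \<tau>])
    fix j assume j: "Suc j < n"
    show "A (\<tau> j) (zigzag n j) (zigzag n (Suc j))"
    proof (cases "j = 1")
      case True
      then show ?thesis using sym[OF i0] \<tau>1 by (simp add: zigzag_def numeral_2_eq_2)
    next
      case False
      have z: "zigzag n 1 = n" "zigzag n 2 = 2" by (auto simp: zigzag_def)
      have "{zigzag n j, zigzag n (Suc j)} \<noteq> {zigzag n 2, zigzag n 1}"
        using False j n zinj[of j 1] zinj[of j 2] zinj[of "Suc j" 1] zinj[of "Suc j" 2]
        unfolding doubleton_eq_iff by auto
      moreover have "zigzag n j + zigzag n (Suc j) \<le> n + 2"
        using j by (auto simp: zigzag_def elim!: evenE oddE)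
      ultimately show ?thesis using z \<tau>m[of j] zm[of j] zm[of "Suc j"] zinj[of j "Suc j"] j
        by (intro edge) auto
    qed
  next
    \<comment> \<open>The closing edge contains \<open>1\<close>, so its endpoints sum to at most
      \<open>n + 1\<close> and it is not \<open>{2, n}\<close>.\<close>
    have z: "zigzag n 0 = 1" by (simp add: zigzag_def)
    have "zigzag n (n - 1) \<noteq> 1" using zinj[of "n - 1" 0] z n by auto
    then show "A (\<tau> (n - 1)) (zigzag n (n - 1)) (zigzag n 0)"
      using z n \<tau>m[of "n - 1"] zm[of "n - 1"] by (intro edge) (auto simp: doubleton_eq_iff)
  qed
qed

subsection \<open>Undoing a shift onto the extremal family\<close>

lemma simple_on_eqI:
  assumes "simple_on n R" "simple_on n S" "x \<noteq> y"
    and "\<And>z. z \<in> {1..n} - {x, y} \<Longrightarrow> R x z = S x z"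
    and "\<And>z. z \<in> {1..n} - {x, y} \<Longrightarrow> R y z = S y z"
    and "R x y = S x y"
    and "\<And>u v. u \<in> {1..n} - {x, y} \<Longrightarrow> v \<in> {1..n} - {x, y} \<Longrightarrow> R u v = S u v"
  shows "R = S"
proof (intro ext)
  fix u v
  have r: "R u v \<longleftrightarrow> R v u" "R u v \<Longrightarrow> u \<noteq> v \<and> u \<in> {1..n} \<and> v \<in> {1..n}" for u v
    using assms(1) unfolding simple_on_def by blast+
  have s: "S u v \<longleftrightarrow> S v u" "S u v \<Longrightarrow> u \<noteq> v \<and> u \<in> {1..n} \<and> v \<in> {1..n}" for u v
    using assms(2) unfolding simple_on_def by blast+
  show "R u v = S u v"
  proof (cases "u \<in> {1..n} \<and> v \<in> {1..n} \<and> u \<noteq> v")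
    case True
    then show ?thesis using assms(3-7) r(1)[of u v] s(1)[of u v] r(1)[of x y] s(1)[of x y]
      by (cases "u \<in> {x, y}"; cases "v \<in> {x, y}") auto
  next
    case False
    then show ?thesis using r(2) s(2) by blast
  qed
qed

text \<open>The assumption changes both coordinates at once. Going through another index and a third
  element of \<open>Z\<close> and back to the same index changes only the second coordinate, so
  \<open>P\<close> spreads everywhere.\<close>

lemma all_or_none:
  assumes step: "\<And>i j z w. \<lbrakk>i \<in> I; j \<in> I; i \<noteq> j; z \<in> Z; w \<in> Z; z \<noteq> w; P i z\<rbrakk> \<Longrightarrow> P j w"
    and I: "card I \<ge> 2" and Z: "card Z \<ge> 3"
  shows "(\<forall>i\<in>I. \<forall>z\<in>Z. P i z) \<or> (\<forall>i\<in>I. \<forall>z\<in>Z. \<not> P i z)"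
proof (rule ccontr)
  assume "\<not> ?thesis"
  then obtain i z j w where h: "i \<in> I" "z \<in> Z" "P i z" "j \<in> I" "w \<in> Z" "\<not> P j w" by blast
  have exI: "\<exists>k\<in>I. k \<noteq> i" for i
  proof (rule ccontr)
    assume "\<not> ?thesis"
    then have "I \<subseteq> {i}" by auto
    then have "card I \<le> 1" using card_mono[of "{i}" I] by simp
    then show False using I by simp
  qed
  have exZ: "\<exists>k\<in>Z. k \<noteq> a \<and> k \<noteq> b" for a b
  proof (rule ccontr)
    assume "\<not> ?thesis"
    then have "Z \<subseteq> {a, b}" by auto
    then have "card Z \<le> card {a, b}" using card_mono[of "{a, b}" Z] by simp
    moreover have "card {a, b} \<le> 2" by (simp add: card_insert_if)
    ultimately show False using Z by simp
  qed
  have same: "P i w" if "i \<in> I" "z \<in> Z" "w \<in> Z" "P i z" for i z w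
    using exI[of i] exZ[of z w] step that by metis
  show False
  proof (cases "i = j")
    case True
    then show False using same h by blast
  next
    case False
    obtain v where "v \<in> Z" "v \<noteq> w" using exZ by blast
    then show False using step[of i j v w] same[of i z v] False h by blast
  qed
qed

lemma simple_on_pendant: "simple_on n (pendant n p q)"
  unfolding simple_on_def pendant_def
  by (intro allI impI, elim conjE, intro conjI) (assumption | erule not_sym)+

text \<open>The shifted graph determines everything except which of \<open>x\<close> and
  \<open>y\<close> owned certain edges. If all graphs agree on this, they are the same extremal
  graph; a disagreement supplies a short rainbow path that \<open>rainbow_of_path\<close>
  completes.\<close>

lemma kelmans_pendant_cases:
  assumes n: "n \<ge> 6" and R: "\<And>i. i \<in> {1..n} \<Longrightarrow> simple_on n (A i)"
    and xy: "x \<in> {1..n}" "y \<in> {1..n}" "x \<noteq> y" and pq: "p \<in> {1..n}" "q \<in> {1..n}" "p \<noteq> q"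
    and K: "\<And>i. i \<in> {1..n} \<Longrightarrow> kelmans x y (A i) = pendant n p q"
  shows "rainbow n A \<or> (\<exists>p\<in>{1..n}. \<exists>q\<in>{1..n}. p \<noteq> q \<and> (\<forall>i\<in>{1..n}. A i = pendant n p q))"
proof -
  let ?I = "{1..n}" and ?Z = "{1..n} - {x, y}"
  have f1: "A i x z \<or> A i y z \<longleftrightarrow> pendant n p q x z" if "i \<in> ?I" "z \<in> ?Z" for i z
    using K[OF that(1), THEN fun_cong, of x, THEN fun_cong, of z] that xy by (auto simp: kelmans_def)
  have f2: "A i x z \<and> A i y z \<longleftrightarrow> pendant n p q y z" if "i \<in> ?I" "z \<in> ?Z" for i z
    using K[OF that(1), THEN fun_cong, of y, THEN fun_cong, of z] that xy by (auto simp: kelmans_def)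
  have f3: "A i x y \<longleftrightarrow> pendant n p q x y" if "i \<in> ?I" for i
    using K[OF that(1), THEN fun_cong, of x, THEN fun_cong, of y] that xy by (auto simp: kelmans_def)
  have f4: "A i u v \<longleftrightarrow> pendant n p q u v" if "i \<in> ?I" "u \<in> ?Z" "v \<in> ?Z" for i u v
    using K[OF that(1), THEN fun_cong, of u, THEN fun_cong, of v] that xy by (auto simp: kelmans_def)
  have sym: "A i u v \<longleftrightarrow> A i v u" if "i \<in> ?I" for i u v
    using R[OF that] unfolding simple_on_def by blast
  note eqI = simple_on_eqI[OF R simple_on_pendant xy(3)]
  have card3: "card {a, b, c} \<le> 3" for a b c :: nat using card_length[of "[a, b, c]"] by simp
  have fresh: "\<exists>z\<in>?I. z \<notin> {a, b, c}" for a b c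
  proof (rule ccontr)
    assume "\<not> ?thesis"
    then have "?I \<subseteq> {a, b, c}" by blast
    then have "card ?I \<le> card {a, b, c}" by (intro card_mono) auto
    then show False using card3[of a b c] n by simp
  qed
  consider "p \<noteq> x" "p \<noteq> y" | "p = x" | "p = y" by blast
  then show ?thesis
  proof cases
    case 1
    \<comment> \<open>If \<open>p\<close> hung at \<open>y\<close> after the shift, it would also be
      adjacent to \<open>x\<close>.\<close>
    have yq: "y \<noteq> q" using f1[of 1 p] f2[of 1 p] 1 pq n xy by (auto simp: pendant_def)
    show ?thesis
    proof (cases "x = q")
      case False
      \<comment> \<open>With \<open>p\<close> and \<open>q\<close> both outside the pair,
        \<open>x\<close> and \<open>y\<close> have the same outside neighbours after the shift, so
        nothing was moved.\<close>
      have "A i = pendant n p q" if i: "i \<in> ?I" for i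
      proof (rule eqI[OF i])
        fix z assume z: "z \<in> ?Z"
        show "A i x z = pendant n p q x z" "A i y z = pendant n p q y z"
          using f1[OF i z] f2[OF i z] z 1 False yq xy by (auto simp: pendant_def)
      qed (use f3[OF i] f4[OF i] in blast)+
      then show ?thesis using pq by blast
    next
      case True
      have xor: "A i x p \<noteq> A i y p" if "i \<in> ?I" for i
        using f1[OF that, of p] f2[OF that, of p] 1 pq yq True by (auto simp: pendant_def)
      have com: "A i u v" if "i \<in> ?I" "u \<in> ?I" "v \<in> ?I" "u \<noteq> v" "u \<noteq> p" "v \<noteq> p" for i u v
      proof -
        have z: "A i x z \<and> A i y z" if "z \<in> ?Z" "z \<noteq> p" for z
          using f2[OF \<open>i \<in> ?I\<close> that(1)] that xy 1 yq by (auto simp: pendant_def)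
        have "A i x y" using f3[OF that(1)] xy 1 by (simp add: pendant_def)
        moreover have "A i u v" if "u \<in> ?Z" "v \<in> ?Z"
          using f4[OF \<open>i \<in> ?I\<close> that] \<open>u \<noteq> v\<close> \<open>u \<noteq> p\<close> \<open>v \<noteq> p\<close> that by (simp add: pendant_def)
        ultimately show ?thesis using that z[of u] z[of v] sym[OF that(1), of u v] sym[OF that(1), of x y]
          by (cases "u \<in> {x, y}"; cases "v \<in> {x, y}") blast+
      qed
      consider "\<forall>i\<in>?I. A i x p" | "\<forall>i\<in>?I. A i y p" | i j where "i \<in> ?I" "j \<in> ?I" "A i x p" "A j y p"
        using xor by blast
      then show ?thesis
      proof cases
        case h: 1
        have "A i = pendant n p x" if i: "i \<in> ?I" for i
        proof (rule eqI[OF i])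
          fix z assume z: "z \<in> ?Z"
          have p: "A i x p" "\<not> A i y p" using h i xor by blast+
          have c: "A i x z" "A i y z" if "z \<noteq> p"
            by (rule com[OF i]; use that z xy 1 in blast)+
          have "A i x z" "A i y z \<longleftrightarrow> z \<noteq> p" using p c by metis+
          then show "A i x z = pendant n p x x z" "A i y z = pendant n p x y z"
            using 1 xy z by (auto simp: pendant_def)
        next
          fix u v assume "u \<in> ?Z" "v \<in> ?Z"
          then show "A i u v = pendant n p x u v" using f4[OF i, of u v] xy pq True by (auto simp: pendant_def)
        qed (use com[OF i, of x y] 1 xy in \<open>simp add: pendant_def\<close>)
        then show ?thesis using 1 xy pq by blast
      next
        case h: 2
        have "A i = pendant n p y" if i: "i \<in> ?I" for i
        proof (rule eqI[OF i])
          fix z assume z: "z \<in> ?Z"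
          have p: "A i y p" "\<not> A i x p" using h i xor by blast+
          have c: "A i x z" "A i y z" if "z \<noteq> p"
            by (rule com[OF i]; use that z xy 1 in blast)+
          have "A i y z" "A i x z \<longleftrightarrow> z \<noteq> p" using p c by metis+
          then show "A i x z = pendant n p y x z" "A i y z = pendant n p y y z"
            using 1 xy z by (auto simp: pendant_def)
        next
          fix u v assume "u \<in> ?Z" "v \<in> ?Z"
          then show "A i u v = pendant n p y u v" using f4[OF i, of u v] xy pq True by (auto simp: pendant_def)
        qed (use com[OF i, of x y] 1 xy in \<open>simp add: pendant_def\<close>)
        then show ?thesis using 1 xy pq by blast
      next
        case h: 3
        then have ij: "i \<noteq> j" using xor by blast
        \<comment> \<open>Only \<open>p\<close> lacks edges, and it becomes the inner vertex of the
          path \<open>x\<close>, \<open>p\<close>, \<open>y\<close>.\<close>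
        have "rainbow n A"
        proof (rule rainbow_of_path[of "[x, p, y]" n "[i, j]"])
          fix l assume "l < length [i, j]"
          then show "A ([i, j] ! l) ([x, p, y] ! l) ([x, p, y] ! Suc l)"
            using h sym by (auto simp: less_Suc_eq)
        next
          fix k u v assume e: "k \<in> ?I" "u \<in> ?I" "v \<in> ?I" "u \<noteq> v"
            and avoid: "\<And>l. 0 < l \<Longrightarrow> l < length [i, j] \<Longrightarrow> u \<noteq> [x, p, y] ! l \<and> v \<noteq> [x, p, y] ! l"
          show "A k u v" using e com[of k u v] avoid[of 1] by simp
        qed (use h ij xy pq 1 n in auto)
        then show ?thesis by blast
      qed
    qed
  next
    case 2
    \<comment> \<open>This case is impossible: a third vertex adjacent to \<open>y\<close> after the
      shift is adjacent to \<open>x\<close> too, so \<open>x\<close> cannot be the pendant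
      vertex.\<close>
    obtain z where z: "z \<in> ?I" "z \<notin> {x, y, q}" using fresh by blast
    then show ?thesis using f1[of 1 z] f2[of 1 z] 2 n xy by (auto simp: pendant_def)
  next
    case 3
    let ?Z' = "?Z - {q}"
    \<comment> \<open>Such a \<open>z\<close> is adjacent to \<open>x\<close> but not to
      \<open>y\<close> after the shift, hence to exactly one of them before.\<close>
    have xor: "A i y z \<longleftrightarrow> \<not> A i x z" if "i \<in> ?I" "z \<in> ?Z'" for i z
      using f1[of i z] f2[of i z] that 3 xy by (auto simp: pendant_def)
    have com: "A i u v" if "i \<in> ?I" "u \<in> ?Z" "v \<in> ?Z" "u \<noteq> v" for i u v
      using f4[OF that(1-3)] that 3 by (auto simp: pendant_def)
    have qq: "A i x q" "A i y q" "\<not> A i x y" if "i \<in> ?I" "q \<noteq> x" for i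
      using f1[of i q] f2[of i q] f3[of i] that 3 pq xy by (auto simp: pendant_def)
    have xq: "A i x y" if "i \<in> ?I" "q = x" for i
      using f3[of i] that 3 pq xy by (auto simp: pendant_def)
    have rb: "rainbow n A" if h: "i \<in> ?I" "j \<in> ?I" "i \<noteq> j" "z \<in> ?Z'" "w \<in> ?Z'" "z \<noteq> w" "A i x z" "A j y w" for i j z w
    proof -
      obtain k where k: "k \<in> ?I" "k \<notin> {i, j}" using fresh[of i j j] by blast
      obtain l where l: "l \<in> ?I" "l \<notin> {i, j, k}" using fresh by blast
      show ?thesis
      proof (cases "q = x")
        case True
        show ?thesis
        proof (rule rainbow_of_path[of "[z, x, y, w]" n "[i, k, j]"])
          fix a assume "a < length [i, k, j]"
          then show "A ([i, k, j] ! a) ([z, x, y, w] ! a) ([z, x, y, w] ! Suc a)"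
            using h sym xq[OF k(1) True] by (auto simp: less_Suc_eq)
        next
          fix b u v assume e: "b \<in> ?I" "u \<in> ?I" "v \<in> ?I" "u \<noteq> v"
            and avoid: "\<And>a. 0 < a \<Longrightarrow> a < length [i, k, j] \<Longrightarrow> u \<noteq> [z, x, y, w] ! a \<and> v \<noteq> [z, x, y, w] ! a"
          show "A b u v" using e com[of b u v] avoid[of 1] avoid[of 2] by simp
        qed (use h k xy n in auto)
      next
        case False
        show ?thesis
        proof (rule rainbow_of_path[of "[z, x, q, y, w]" n "[i, k, l, j]"])
          fix a assume "a < length [i, k, l, j]"
          then show "A ([i, k, l, j] ! a) ([z, x, q, y, w] ! a) ([z, x, q, y, w] ! Suc a)"
            using h sym qq[OF k(1) False] qq[OF l(1) False] l(1) by (auto simp: less_Suc_eq)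
        next
          fix b u v assume e: "b \<in> ?I" "u \<in> ?I" "v \<in> ?I" "u \<noteq> v"
            and avoid: "\<And>a. 0 < a \<Longrightarrow> a < length [i, k, l, j] \<Longrightarrow> u \<noteq> [z, x, q, y, w] ! a \<and> v \<noteq> [z, x, q, y, w] ! a"
          show "A b u v" using e com[of b u v] avoid[of 1] avoid[of 3] by simp
        qed (use h k l xy n pq False 3 in auto)
      qed
    qed
    show ?thesis
    proof (cases "rainbow n A")
      case nr: False
      \<comment> \<open>The three vertices demanded by \<open>all_or_none\<close> come from
        \<open>n\<close> being at least \<open>6\<close>; its propagation hypothesis is the absence
        of a rainbow cycle, through \<open>rb\<close> and \<open>xor\<close>.\<close>
      have "n - 3 \<le> card ?Z'"
      proof -
        have "?Z' = ?I - {x, y, q}" by auto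
        then have "card ?Z' \<ge> card ?I - card {x, y, q}" using diff_card_le_card_Diff[of "{x, y, q}" ?I] by simp
        moreover note card3[of x y q]
        ultimately show ?thesis by simp
      qed
      then have "(\<forall>i\<in>?I. \<forall>z\<in>?Z'. A i x z) \<or> (\<forall>i\<in>?I. \<forall>z\<in>?Z'. \<not> A i x z)"
        using n rb xor nr by (intro all_or_none) (blast | simp)+
      then show ?thesis
      proof
        assume h: "\<forall>i\<in>?I. \<forall>z\<in>?Z'. A i x z"
        have "A i = pendant n y q" if i: "i \<in> ?I" for i
        proof (rule eqI[OF i])
          fix z assume z: "z \<in> ?Z"
          have "A i x z \<and> (A i y z \<longleftrightarrow> z = q)"
          proof (cases "z = q")
            case True
            then show ?thesis using qq[OF i] z by blast
          next
            case False
            then have "z \<in> ?Z'" using z by blast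
            then show ?thesis using h i xor[OF i] False by blast
          qed
          then show "A i x z = pendant n y q x z" "A i y z = pendant n y q y z"
            using z xy by (auto simp: pendant_def)
        next
          show "A i x y = pendant n y q x y" using qq[OF i] xq[OF i] xy by (auto simp: pendant_def)
        qed (use f4[OF i] 3 in auto)
        then show ?thesis using pq 3 by blast
      next
        assume h: "\<forall>i\<in>?I. \<forall>z\<in>?Z'. \<not> A i x z"
        \<comment> \<open>In this branch \<open>x\<close> is the pendant vertex of every original
          graph; if \<open>q = x\<close>, its only neighbour is \<open>y\<close>.\<close>
        define q' where "q' = (if q = x then y else q)"
        have "A i = pendant n x q'" if i: "i \<in> ?I" for i
        proof (rule eqI[OF i])
          fix z assume z: "z \<in> ?Z"
          have "A i y z \<and> (A i x z \<longleftrightarrow> z = q)"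
          proof (cases "z = q")
            case True
            then show ?thesis using qq[OF i] z by blast
          next
            case False
            then have "z \<in> ?Z'" using z by blast
            then show ?thesis using h i xor[OF i] False by blast
          qed
          moreover have "z = q \<longleftrightarrow> z = q'" using z by (auto simp: q'_def)
          ultimately show "A i x z = pendant n x q' x z" "A i y z = pendant n x q' y z"
            using z xy by (auto simp: pendant_def)
        next
          show "A i x y = pendant n x q' x y" using qq[OF i] xq[OF i] xy 3 pq by (auto simp: pendant_def q'_def)
        next
          fix u v assume "u \<in> ?Z" "v \<in> ?Z"
          then show "A i u v = pendant n x q' u v" using f4[OF i, of u v] 3 by (auto simp: pendant_def)
        qed
        moreover have "q' \<in> ?I" "x \<noteq> q'" using xy pq by (auto simp: q'_def)
        ultimately show ?thesis using xy by blast
      qed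
    qed blast
  qed
qed

section \<open>Induction over shifts\<close>

text \<open>Induction on the label-weighted degree sum of the whole family: a common shift never
  raises the contribution of any graph and lowers that of each graph it changes.\<close>

lemma rainbow_or_pendant:
  assumes n: "n \<ge> 6" and "\<And>i. i \<in> {1..n} \<Longrightarrow> simple_on n (A i)"
    and "\<And>i. i \<in> {1..n} \<Longrightarrow> (n - 1) * (n - 2) < (\<Sum>u=1..n. deg n (A i) u)"
  shows "rainbow n A \<or> (\<exists>p\<in>{1..n}. \<exists>q\<in>{1..n}. p \<noteq> q \<and> (\<forall>i\<in>{1..n}. A i = pendant n p q))"
  using assms(2-)
proof (induction "\<Sum>i=1..n. \<Sum>u=1..n. u * deg n (A i) u" arbitrary: A rule: less_induct)
  case less
  show ?case
  proof (cases "\<exists>i\<in>{1..n}. \<exists>x\<in>{1..n}. \<exists>y\<in>{1..n}. x < y \<and> kelmans x y (A i) \<noteq> A i")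
    case True
    then obtain i x y where ixy: "i \<in> {1..n}" "x \<in> {1..n}" "y \<in> {1..n}" "x < y" "kelmans x y (A i) \<noteq> A i" by blast
    let ?A = "\<lambda>i. kelmans x y (A i)"
    have "(\<Sum>i=1..n. \<Sum>u=1..n. u * deg n (?A i) u) < (\<Sum>i=1..n. \<Sum>u=1..n. u * deg n (A i) u)"
      by (rule sum_strict_mono_ex1)
        (use weighted_deg_kelmans[OF ixy(2-4) less.prems(1)] ixy in \<open>auto intro!: bexI[of _ i]\<close>)
    then have "rainbow n ?A \<or> (\<exists>p\<in>{1..n}. \<exists>q\<in>{1..n}. p \<noteq> q \<and> (\<forall>i\<in>{1..n}. ?A i = pendant n p q))"
    proof (rule less.hyps)
      fix i assume i: "i \<in> {1..n}"
      show "simple_on n (?A i)" using simple_on_kelmans less.prems(1) i ixy by blast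
      show "(n - 1) * (n - 2) < (\<Sum>u=1..n. deg n (?A i) u)"
        using sum_deg_kelmans[OF ixy(2,3) _ less.prems(1)[OF i]] ixy less.prems(2)[OF i] by simp
    qed
    then show ?thesis
    proof
      assume "rainbow n ?A"
      then have "rainbow n A" using ixy n less.prems(1) by (intro rainbow_kelmans[of n A x y]) auto
      then show ?thesis by blast
    next
      assume "\<exists>p\<in>{1..n}. \<exists>q\<in>{1..n}. p \<noteq> q \<and> (\<forall>i\<in>{1..n}. ?A i = pendant n p q)"
      then obtain p q where pq: "p \<in> {1..n}" "q \<in> {1..n}" "p \<noteq> q" "\<And>i. i \<in> {1..n} \<Longrightarrow> ?A i = pendant n p q" by blast
      show ?thesis by (rule kelmans_pendant_cases[OF n less.prems(1) ixy(2,3) _ pq]) (use ixy(4) in auto)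
    qed
  next
    case False
    then have st: "\<And>i x y. \<lbrakk>i \<in> {1..n}; x \<in> {1..n}; y \<in> {1..n}; x < y\<rbrakk> \<Longrightarrow> kelmans x y (A i) = A i" by blast
    show ?thesis
    proof (cases "\<exists>i\<in>{1..n}. A i 2 n")
      case True
      then obtain i0 where i0: "i0 \<in> {1..n}" "A i0 2 n" by blast
      have "rainbow n A" by (rule rainbow_shifted[where A = A, OF n less.prems st i0])
      then show ?thesis by blast
    next
      case False
      then have "\<forall>i\<in>{1..n}. A i = pendant n n 1"
        by (intro ballI shifted_eq_pendant[OF n less.prems st]) blast+
      moreover have "n \<in> {1..n}" "1 \<in> {1..n}" "n \<noteq> 1" using n by auto
      ultimately show ?thesis by blast
    qed
  qed
qed

subsection \<open>The extremal graph as an edge set\<close>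

lemma rainbow_ham_cycle_if_rainbow:
  assumes "rainbow n (\<lambda>i u v. {u, v} \<in> G i)"
  shows "rainbow_ham_cycle n G"
proof -
  obtain c \<tau> where c: "bij_betw c {0..<n} {1..n}" and \<tau>: "bij_betw \<tau> {0..<n} {1..n}"
    and e: "\<forall>j<n. {c j, c (Suc j mod n)} \<in> G (\<tau> j)"
    using assms unfolding rainbow_def by blast
  let ?\<sigma> = "inv_into {0..<n} \<tau>"
  have \<sigma>: "bij_betw ?\<sigma> {1..n} {0..<n}" by (rule bij_betw_inv_into[OF \<tau>])
  have "{c (?\<sigma> i), c ((?\<sigma> i + 1) mod n)} \<in> G i" if i: "i \<in> {1..n}" for i
  proof -
    have "?\<sigma> i < n" using bij_betwE[OF \<sigma>] i by auto
    moreover have "\<tau> (?\<sigma> i) = i" by (rule bij_betw_inv_into_right[OF \<tau> i])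
    ultimately show ?thesis using e by (metis Suc_eq_plus1)
  qed
  then show ?thesis unfolding rainbow_ham_cycle_def using c \<sigma> by blast
qed

lemma K1_join_Kn2_K1_eq_pendant:
  assumes "n \<ge> 2"
  shows "K1_join_Kn2_K1 n = {{u, v} | u v. pendant n n (n - 1) u v}"
proof
  show "K1_join_Kn2_K1 n \<subseteq> {{u, v} | u v. pendant n n (n - 1) u v}"
  proof
    fix e assume "e \<in> K1_join_Kn2_K1 n"
    then consider u v where "e = {u, v}" "u \<in> {1..n-1}" "v \<in> {1..n-1}" "u \<noteq> v" | "e = {n - 1, n}"
      unfolding K1_join_Kn2_K1_def by blast
    then show "e \<in> {{u, v} | u v. pendant n n (n - 1) u v}"
    proof cases
      case 1
      then have "pendant n n (n - 1) u v" using assms by (auto simp: pendant_def)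
      then show ?thesis using 1(1) by blast
    next
      case 2
      have "pendant n n (n - 1) (n - 1) n" using assms by (auto simp: pendant_def)
      then show ?thesis using 2 by blast
    qed
  qed
next
  show "{{u, v} | u v. pendant n n (n - 1) u v} \<subseteq> K1_join_Kn2_K1 n"
  proof
    fix e assume "e \<in> {{u, v} | u v. pendant n n (n - 1) u v}"
    then obtain u v where e: "e = {u, v}" and p: "pendant n n (n - 1) u v" by blast
    show "e \<in> K1_join_Kn2_K1 n"
    proof (cases "u = n \<or> v = n")
      case True
      then have "e = {n - 1, n}" using e p by (auto simp: pendant_def)
      then show ?thesis by (simp add: K1_join_Kn2_K1_def)
    next
      case False
      then have "u \<in> {1..n-1}" "v \<in> {1..n-1}" "u \<noteq> v" using p by (auto simp: pendant_def)
      then show ?thesis using e unfolding K1_join_Kn2_K1_def by blast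
    qed
  qed
qed

lemma graph_iso_pendant:
  assumes "p \<in> {1..n}" "q \<in> {1..n}" "p \<noteq> q"
  shows "graph_iso n {{u, v} | u v. pendant n p q u v} (K1_join_Kn2_K1 n)"
proof -
  have n: "n \<ge> 2" using assms by auto
  have "distinct [p, q]" "set [p, q] \<subseteq> {1..n}" using assms by auto
  then obtain c where c: "bij_betw c {0..<n} {1..n}" and cj: "\<And>j. j < length [p, q] \<Longrightarrow> c j = [p, q] ! j"
    using extend_distinct_list by blast
  \<comment> \<open>The list \<open>c\<close> begins with \<open>p\<close>, \<open>q\<close>;
    reversing the labels makes \<open>n\<close> go to \<open>p\<close> and \<open>n - 1\<close> to
    \<open>q\<close>.\<close>
  define f where "f = c \<circ> (\<lambda>u. n - u)"
  have "bij_betw (\<lambda>u. n - u) {1..n} {0..<n}"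
    by (rule bij_betw_byWitness[where f' = "\<lambda>u. n - u"]) auto
  then have f: "bij_betw f {1..n} {1..n}" unfolding f_def using c by (rule bij_betw_trans)
  have fn: "f n = p" "f (n - 1) = q" using cj[of 0] cj[of 1] n by (auto simp: f_def)
  have finj: "f a = f b \<longleftrightarrow> a = b" if "a \<in> {1..n}" "b \<in> {1..n}" for a b
    using f that unfolding bij_betw_def inj_on_def by blast
  have fm: "f a \<in> {1..n}" if "a \<in> {1..n}" for a using f that by (rule bij_betwE[THEN bspec])
  have iff: "pendant n p q (f a) (f b) \<longleftrightarrow> pendant n n (n - 1) a b" if "a \<in> {1..n}" "b \<in> {1..n}" for a b
  proof -
    have "f a = p \<longleftrightarrow> a = n" "f b = p \<longleftrightarrow> b = n" "f a = q \<longleftrightarrow> a = n - 1" "f b = q \<longleftrightarrow> b = n - 1"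
      using finj[of a n] finj[of b n] finj[of a "n - 1"] finj[of b "n - 1"] that n fn by auto
    then show ?thesis unfolding pendant_def using finj[OF that] fm[OF that(1)] fm[OF that(2)] that by simp
  qed
  have "{{u, v} | u v. pendant n p q u v} = (\<lambda>e. f ` e) ` {{u, v} | u v. pendant n n (n - 1) u v}" (is "?L = ?R")
  proof
    show "?L \<subseteq> ?R"
    proof
      fix e assume "e \<in> ?L"
      then obtain u v where e: "e = {u, v}" and uv: "pendant n p q u v" by blast
      then have "u \<in> f ` {1..n}" "v \<in> f ` {1..n}" using f by (simp_all add: bij_betw_def pendant_def)
      then obtain a b where ab: "a \<in> {1..n}" "b \<in> {1..n}" "u = f a" "v = f b" by blast
      then have "pendant n n (n - 1) a b" using iff uv by blast
      moreover have "e = f ` {a, b}" using e ab by simp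
      ultimately show "e \<in> ?R" by blast
    qed
    show "?R \<subseteq> ?L"
    proof
      fix e assume "e \<in> ?R"
      then obtain a b where e: "e = f ` {a, b}" and ab: "pendant n n (n - 1) a b" by blast
      then have "pendant n p q (f a) (f b)" using iff by (simp add: pendant_def)
      moreover have "e = {f a, f b}" using e by simp
      ultimately show "e \<in> ?L" by blast
    qed
  qed
  then show ?thesis unfolding graph_iso_def K1_join_Kn2_K1_eq_pendant[OF n] using f by blast
qed

theorem mainTheorem3:
  fixes n :: nat and G :: "nat \<Rightarrow> nat set set"
  assumes "n \<ge> 6"
    and "\<forall>i\<in>{1..n}. is_graph n (G i)"
    and "\<forall>i\<in>{1..n}. rho_S n (G i) > 2 * real n - 4"
    and "\<not> ((\<forall>i\<in>{1..n}. G i = G 1) \<and> graph_iso n (G 1) (K1_join_Kn2_K1 n))"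
  shows "rainbow_ham_cycle n G"
proof -
  let ?A = "\<lambda>i u v. {u, v} \<in> G i"
  have edge: "\<exists>u v. e = {u, v} \<and> u \<noteq> v \<and> u \<in> {1..n} \<and> v \<in> {1..n}" if "i \<in> {1..n}" "e \<in> G i" for i e
    using assms(2) that unfolding is_graph_def by blast
  have "simple_on n (?A i)" if i: "i \<in> {1..n}" for i
    unfolding simple_on_def
  proof (intro allI impI)
    fix u v assume uv: "{u, v} \<in> G i"
    obtain a b where "{u, v} = {a, b}" "a \<noteq> b" "a \<in> {1..n}" "b \<in> {1..n}" using edge[OF i uv] by blast
    then have "u \<noteq> v \<and> u \<in> {1..n} \<and> v \<in> {1..n}" by (auto simp: doubleton_eq_iff)
    then show "{v, u} \<in> G i \<and> u \<noteq> v \<and> u \<in> {1..n} \<and> v \<in> {1..n}" using uv by (simp add: insert_commute)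
  qed
  moreover have "(n - 1) * (n - 2) < (\<Sum>u=1..n. deg n (?A i) u)" if i: "i \<in> {1..n}" for i
    using degree_sum_gt_if_rho_S_gt[of n "G i"] assms i unfolding deg_def
    by (simp add: degree_eq_sum[of n "G i"])
  ultimately consider "rainbow n ?A"
    | p q where "p \<in> {1..n}" "q \<in> {1..n}" "p \<noteq> q" "\<forall>i\<in>{1..n}. ?A i = pendant n p q"
    using rainbow_or_pendant[OF assms(1), of ?A] by blast
  then show ?thesis
  proof cases
    case 1
    then show ?thesis by (rule rainbow_ham_cycle_if_rainbow)
  next
    case 2
    have eq: "G i = {{u, v} | u v. pendant n p q u v}" if i: "i \<in> {1..n}" for i
    proof -
      have "G i = {{u, v} | u v. {u, v} \<in> G i}" using edge[OF i] by blast
      moreover have "{u, v} \<in> G i \<longleftrightarrow> pendant n p q u v" for u v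
        using fun_cong[OF fun_cong[OF bspec[OF 2(4) i], of u], of v] .
      ultimately show ?thesis by simp
    qed
    then have "\<forall>i\<in>{1..n}. G i = G 1" "graph_iso n (G 1) (K1_join_Kn2_K1 n)"
      using graph_iso_pendant[OF 2(1-3)] assms(1) by auto
    then show ?thesis using assms(4) by blast
  qed
qed

end
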